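(* Let $n\ge 2$, let $k$ be any field of characteristic $2$, and let $E=k(\alpha_0,\dots,\alpha_n)$ be the function field in $n+1$ algebraically independent variables over $k$. There is a strongly tight set of $n+1$ quadratic $n$-fold Pfister forms over $E$ with no common quadratic or bilinear $1$-fold Pfister subform (in particular, the set is neither left-linked nor right-linked).
   Context: $[a,b]$ denotes the quadratic form $ax^2+xy+by^2$. For a field $F$ of characteristic $2$, $I_q^1F$ is the group of Witt classes of even-dimensional nonsingular quadratic forms over $F$ under orthogonal sum. Bilinear Pfister forms: $\langle\langle\beta\rangle\rangle=\langle 1,\beta\rangle$ (diagonal symmetric bilinear form) and $\langle\langle\beta_1,\dots,\beta_m\rangle\rangle=\langle\langle\beta_1\rangle\rangle\otimes\cdots\otimes\langle\langle\beta_m\rangle\rangle$, $\beta_i\in F^\times$. Quadratic Pfister forms: $\langle\langle\alpha]]=[1,\alpha]$ and $\langle\langle\beta_1,\dots,\beta_{n-1},\alpha]]=\langle\langle\beta_1,\dots,\beta_{n-1}\rangle\rangle\otimes\langle\langle\alpha]]$. $I_q^nF$ is the subgroup of $I_q^1F$ generated by scalar multiples of quadratic $n$-fold Pfister forms. A set of quadratic $n$-fold Pfister forms is strongly tight if the subgroup it generates in $I_q^nF$ consists of (Witt classes of) $n$-fold Pfister forms. It is right-linked if there is a quadratic $(n-1)$-fold Pfister form $\rho$ such that every form in the set is isometric to $\langle\langle\beta\rangle\rangle\otimes\rho$ for some $\beta\in F^\times$; it is left-linked if there is a bilinear $(n-1)$-fold Pfister form $b$ such that every form in the set is isometric to $b\otimes\langle\langle\alpha]]$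 for some $\alpha\in F$. A quadratic form $\rho$ is a subform of a quadratic form $\psi$ if $\rho$ is isometric to the restriction of $\psi$ to a subspace. A common quadratic $1$-fold Pfister subform is a form $[1,\alpha]$ which is a subform of every form in the set; a common bilinear $1$-fold Pfister subform is a bilinear form $\langle\langle\beta\rangle\rangle$, $\beta\in F^\times$, whose associated $2$-dimensional quadratic form $x^2+\beta y^2$ is a subform of every form in the set. *)

theory Defs
  imports
    "Jordan_Normal_Form.Matrix"
    "HOL-Algebra.Generated_Groups"
    "HOL-Library.Poly_Mapping"
    "HOL-Computational_Algebra.Computational_Algebra"
begin

section \<open>Rational function fields\<close>

text \<open>
  A polynomial in variables indexed by \<^typ>\<open>nat\<close> is a finitely supported map from exponent vectors
  to coefficients.  It involves only the variables of index at most \<open>n\<close> iff all its exponent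
  vectors are supported on \<open>{..n}\<close>.
\<close>

definition polys_upto :: "nat \<Rightarrow> ((nat \<Rightarrow>\<^sub>0 nat) \<Rightarrow>\<^sub>0 'k::zero) set" where
  "polys_upto n = {p. \<forall>m \<in> Poly_Mapping.keys p. Poly_Mapping.keys m \<subseteq> {..n}}"

definition poly_eval ::
    "('k::field \<Rightarrow> 'e::field) \<Rightarrow> (nat \<Rightarrow> 'e) \<Rightarrow> ((nat \<Rightarrow>\<^sub>0 nat) \<Rightarrow>\<^sub>0 'k) \<Rightarrow> 'e" where
  "poly_eval \<iota> \<alpha> p =
    (\<Sum>m\<in>Poly_Mapping.keys p. \<iota> (Poly_Mapping.lookup p m) * (\<Prod>i\<in>Poly_Mapping.keys m. \<alpha> i ^ Poly_Mapping.lookup m i))"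

definition algebraically_independent ::
    "('k::field \<Rightarrow> 'e::field) \<Rightarrow> nat \<Rightarrow> (nat \<Rightarrow> 'e) \<Rightarrow> bool" where
  "algebraically_independent \<iota> n \<alpha> \<longleftrightarrow>
    (\<forall>p \<in> polys_upto n. poly_eval \<iota> \<alpha> p = 0 \<longrightarrow> p = 0)"

text \<open>
  The type \<open>'e\<close>, with the embedding \<open>\<iota>\<close> of the base field \<open>'k\<close>, is the function field in the
  \<open>n + 1\<close> algebraically independent variables \<open>\<alpha> 0, \<dots>, \<alpha> n\<close>.  The values of \<open>\<alpha>\<close> beyond \<open>n\<close> are
  irrelevant.
\<close>

definition rational_function_field ::
    "('k::field \<Rightarrow> 'e::field) \<Rightarrow> nat \<Rightarrow> (nat \<Rightarrow> 'e) \<Rightarrow> bool" where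
  "rational_function_field \<iota> n \<alpha> \<longleftrightarrow>
    field_hom \<iota> \<and>
    algebraically_independent \<iota> n \<alpha> \<and>
    (\<forall>x. \<exists>p \<in> polys_upto n. \<exists>q \<in> polys_upto n.
        poly_eval \<iota> \<alpha> q \<noteq> 0 \<and> x = poly_eval \<iota> \<alpha> p / poly_eval \<iota> \<alpha> q)"


section \<open>Quadratic forms\<close>

text \<open>
  A square matrix \<open>A\<close> of size \<open>d\<close>, not necessarily symmetric, represents the \<open>d\<close>-dimensional quadratic
  form \<open>v \<mapsto> v\<^sup>T A v\<close>.  Different matrices may represent the same form (in which case they are
  isometric in the sense below).  A symmetric bilinear form is represented by its Gram matrix \<open>B\<close>;
  the very same matrix then represents the associated quadratic form \<open>v \<mapsto> B(v, v)\<close>.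
\<close>

definition quad_eval :: "'a::field mat \<Rightarrow> 'a vec \<Rightarrow> 'a" where
  "quad_eval A v = v \<bullet> (A *\<^sub>v v)"

definition polar :: "'a::field mat \<Rightarrow> 'a vec \<Rightarrow> 'a vec \<Rightarrow> 'a" where
  "polar A v w = quad_eval A (v + w) - quad_eval A v - quad_eval A w"

definition nonsingular_form :: "'a::field mat \<Rightarrow> bool" where
  "nonsingular_form A \<longleftrightarrow>
    (\<forall>v \<in> carrier_vec (dim_row A).
      (\<forall>w \<in> carrier_vec (dim_row A). polar A v w = 0) \<longrightarrow> v = 0\<^sub>v (dim_row A))"

definition isometric :: "'a::field mat \<Rightarrow> 'a mat \<Rightarrow> bool" where
  "isometric A B \<longleftrightarrow> dim_row A = dim_row B \<and>
    (\<exists>T \<in> carrier_mat (dim_row A) (dim_row A). invertible_mat T \<and>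
      (\<forall>v \<in> carrier_vec (dim_row A). quad_eval B (T *\<^sub>v v) = quad_eval A v))"

text \<open>
  \<open>T\<close> is an isometry from \<open>A\<close> onto the restriction of \<open>B\<close> to the subspace that is the image of \<open>T\<close>.
  Injectivity has to be required, since \<open>A\<close> may be totally singular.
\<close>

definition subform :: "'a::field mat \<Rightarrow> 'a mat \<Rightarrow> bool" where
  "subform A B \<longleftrightarrow>
    (\<exists>T \<in> carrier_mat (dim_row B) (dim_row A).
      inj_on (\<lambda>v. T *\<^sub>v v) (carrier_vec (dim_row A)) \<and>
      (\<forall>v \<in> carrier_vec (dim_row A). quad_eval B (T *\<^sub>v v) = quad_eval A v))"

definition orth_sum :: "'a::field mat \<Rightarrow> 'a mat \<Rightarrow> 'a mat" where
  "orth_sum A B = diag_block_mat [A, B]"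

text \<open>\<open>binary_form a b\<close> is \<open>a x\<^sup>2 + x y + b y\<^sup>2\<close>.\<close>

definition binary_form :: "'a::field \<Rightarrow> 'a \<Rightarrow> 'a mat" where
  "binary_form a b = mat_of_rows_list 2 [[a, 1], [0, b]]"

text \<open>\<open>binary_form 0 0\<close> is the hyperbolic plane.\<close>

definition hyperbolic :: "nat \<Rightarrow> 'a::field mat" where
  "hyperbolic m = diag_block_mat (replicate m (binary_form 0 0))"

text \<open>
  Kronecker product.  If both factors are Gram matrices, this is the Gram matrix of the tensor
  product.  If \<open>B\<close> is the Gram matrix of a symmetric bilinear form and \<open>A\<close> represents a quadratic form,
  it represents the quadratic form \<open>B \<otimes> A\<close>, which takes the value \<open>B(v, v) A(w)\<close> at \<open>v \<otimes> w\<close> and whose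
  polar form is the tensor product of \<open>B\<close> with the polar form of \<open>A\<close>.
\<close>

definition tensor :: "'a::field mat \<Rightarrow> 'a mat \<Rightarrow> 'a mat" where
  "tensor B A = mat (dim_row B * dim_row A) (dim_col B * dim_col A)
    (\<lambda>(i, j). B $$ (i div dim_row A, j div dim_col A) * A $$ (i mod dim_row A, j mod dim_col A))"


section \<open>Witt classes\<close>

definition ns_forms :: "'a::field mat set" where
  "ns_forms = {A. square_mat A \<and> even (dim_row A) \<and> nonsingular_form A}"

definition witt_equivalent :: "'a::field mat \<Rightarrow> 'a mat \<Rightarrow> bool" where
  "witt_equivalent A B \<longleftrightarrow>
    (\<exists>r s. isometric (orth_sum A (hyperbolic r)) (orth_sum B (hyperbolic s)))"

definition witt_class :: "'a::field mat \<Rightarrow> 'a mat set" where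
  "witt_class A = {B \<in> ns_forms. witt_equivalent A B}"

text \<open>The group $I_q^1 F$; the neutral element is the class of the form of dimension 0.\<close>

definition Iq1 :: "'a::field mat set monoid" where
  "Iq1 = \<lparr>carrier = witt_class ` ns_forms,
          mult = (\<lambda>X Y. \<Union>A\<in>X. \<Union>B\<in>Y. witt_class (orth_sum A B)),
          one = witt_class (0\<^sub>m 0 0)\<rparr>"


section \<open>Pfister forms\<close>

definition bpfister1 :: "'a::field \<Rightarrow> 'a mat" where
  "bpfister1 \<beta> = mat_of_rows_list 2 [[1, 0], [0, \<beta>]]"

primrec bpfister :: "'a::field list \<Rightarrow> 'a mat" where
  "bpfister [] = 1\<^sub>m 1"
| "bpfister (\<beta> # \<beta>s) = tensor (bpfister1 \<beta>) (bpfister \<beta>s)"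

definition qpfister1 :: "'a::field \<Rightarrow> 'a mat" where
  "qpfister1 \<alpha> = binary_form 1 \<alpha>"

definition bilinear_pfister_forms :: "nat \<Rightarrow> 'a::field mat set" where
  "bilinear_pfister_forms m = {bpfister \<beta>s | \<beta>s. length \<beta>s = m \<and> 0 \<notin> set \<beta>s}"

text \<open>Only meaningful for \<open>n \<ge> 1\<close>.\<close>

definition quadratic_pfister_forms :: "nat \<Rightarrow> 'a::field mat set" where
  "quadratic_pfister_forms n =
    {tensor (bpfister \<beta>s) (qpfister1 \<alpha>) | \<beta>s \<alpha>. length \<beta>s = n - 1 \<and> 0 \<notin> set \<beta>s}"

text \<open>The subgroup $I_q^n F$ of $I_q^1 F$, as a group.\<close>

definition Iq :: "nat \<Rightarrow> 'a::field mat set monoid" where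
  "Iq n = Iq1\<lparr>carrier :=
    generate Iq1 {witt_class (c \<cdot>\<^sub>m P) | c P. c \<noteq> 0 \<and> P \<in> quadratic_pfister_forms n}\<rparr>"


section \<open>Tightness and linkage\<close>

definition strongly_tight :: "nat \<Rightarrow> 'a::field mat set \<Rightarrow> bool" where
  "strongly_tight n S \<longleftrightarrow>
    generate (Iq n) (witt_class ` S) \<subseteq> witt_class ` quadratic_pfister_forms n"

definition right_linked :: "nat \<Rightarrow> 'a::field mat set \<Rightarrow> bool" where
  "right_linked n S \<longleftrightarrow>
    (\<exists>\<rho> \<in> quadratic_pfister_forms (n - 1). \<forall>\<phi> \<in> S. \<exists>\<beta>. \<beta> \<noteq> 0 \<and>
      isometric \<phi> (tensor (bpfister1 \<beta>) \<rho>))"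

definition left_linked :: "nat \<Rightarrow> 'a::field mat set \<Rightarrow> bool" where
  "left_linked n S \<longleftrightarrow>
    (\<exists>b \<in> bilinear_pfister_forms (n - 1). \<forall>\<phi> \<in> S. \<exists>\<alpha>.
      isometric \<phi> (tensor b (qpfister1 \<alpha>)))"

definition common_quadratic_subform :: "'a::field mat set \<Rightarrow> bool" where
  "common_quadratic_subform S \<longleftrightarrow> (\<exists>\<alpha>. \<forall>\<phi> \<in> S. subform (qpfister1 \<alpha>) \<phi>)"

text \<open>Here \<^term>\<open>bpfister1 \<beta>\<close> is read as the associated quadratic form \<open>x\<^sup>2 + \<beta> y\<^sup>2\<close>.\<close>

definition common_bilinear_subform :: "'a::field mat set \<Rightarrow> bool" where
  "common_bilinear_subform S \<longleftrightarrow> (\<exists>\<beta>. \<beta> \<noteq> 0 \<and> (\<forall>\<phi> \<in> S. subform (bpfister1 \<beta>) \<phi>))"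

end

theory Submission
  imports Defs "Jordan_Normal_Form.Determinant" "HOL-Library.Infinite_Set"
begin

text \<open>
  For \<open>y\<^sub>1, \<dots>, y\<^sub>n\<close> in a field of characteristic two let \<open>P(y\<^sub>1, \<dots>, y\<^sub>n)\<close> be the Pfister form
  \<open>\<langle>\<langle>y\<^sub>2, \<dots>, y\<^sub>n, y\<^sub>1\<cdots>y\<^sub>n]]\<close>.  Its Witt class is the sum of the classes \<open>[\<Prod>S, \<Prod>S']\<close> over the
  partitions \<open>{S, S'}\<close> of \<open>{y\<^sub>1, \<dots>, y\<^sub>n}\<close>, hence symmetric in the \<open>y\<^sub>i\<close>, additive in each of them, and
  zero if two of them agree.  The forms of the theorem are the \<open>P\<close> of the variables
  \<open>\<alpha>\<^sub>0, \<dots>, \<alpha>\<^sub>n\<close> with one of them, \<open>\<alpha>\<^sub>i\<close>, omitted.  By multilinearity, the sum of these classes over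
  \<open>i \<in> I\<close> is the class of one form \<open>P\<close>, with \<open>\<alpha>\<^sub>k\<close> omitted for some \<open>k \<in> I\<close> and \<open>\<alpha>\<^sub>j\<close> replaced by
  \<open>\<alpha>\<^sub>j + \<alpha>\<^sub>k\<close> for the other \<open>j \<in> I\<close>.

  For the absolute value given by a monomial order, the \<open>2^n\<close> diagonal terms of the form omitting
  \<open>\<alpha>\<^sub>i\<close> have leading terms in different square classes and dominate the mixed terms.  So the form is
  anisotropic, its values have a square leading coefficient and even degree in \<open>\<alpha>\<^sub>i\<close>, and its polar
  form satisfies \<open>|b(v, w)|\<^sup>2 < |q(v)| |q(w)|\<close> for nonzero \<open>v\<close> and \<open>w\<close>.  A plane contained in all of the
  forms would then only have values with square leading term, and such a term can always be
  cancelled by moving in the direction of a vector of value \<open>1\<close>; infinite descent excludes this.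
\<close>

no_notation fps_nth (infixl \<open>$\<close> 75)

section \<open>Isometries of nonsingular forms\<close>

lemma ns_formsI:
  "A \<in> carrier_mat n n \<Longrightarrow> even n \<Longrightarrow> nonsingular_form A \<Longrightarrow> A \<in> ns_forms"
  by (auto simp: ns_forms_def)

lemma ns_nonsingular: "A \<in> ns_forms \<Longrightarrow> nonsingular_form A"
  by (simp add: ns_forms_def)

lemma ns_carrier: "A \<in> ns_forms \<Longrightarrow> dim_row A = n \<Longrightarrow> A \<in> carrier_mat n n"
  by (auto simp: ns_forms_def)

lemma ns_obtain:
  assumes "A \<in> ns_forms"
  obtains n where "A \<in> carrier_mat n n" "even n" "nonsingular_form A"
proof
  show "A \<in> carrier_mat (dim_row A) (dim_row A)" by (rule ns_carrier[OF assms refl])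
qed (use assms in \<open>simp_all add: ns_forms_def\<close>)

lemma vec_append_cases:
  assumes "v \<in> carrier_vec (n + m)"
  obtains v1 v2 where "v1 \<in> carrier_vec n" "v2 \<in> carrier_vec m" "v = v1 @\<^sub>v v2"
  using that[of "vec_first v n" "vec_last v m"] assms by simp

lemma append_zero_vec: "0\<^sub>v n @\<^sub>v 0\<^sub>v m = 0\<^sub>v (n + m)"
  by (intro eq_vecI) auto

lemma quad_eval_zero [simp]: "A \<in> carrier_mat n n \<Longrightarrow> quad_eval A (0\<^sub>v n) = 0"
  by (auto simp: quad_eval_def)

lemma quad_eval_smult_mat:
  assumes "A \<in> carrier_mat n n" "v \<in> carrier_vec n"
  shows "quad_eval (c \<cdot>\<^sub>m A) v = c * quad_eval A v"
proof -
  have "(c \<cdot>\<^sub>m A) *\<^sub>v v = c \<cdot>\<^sub>v (A *\<^sub>v v)"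
    using assms by (intro eq_vecI) (auto simp: scalar_prod_def sum_distrib_left mult.assoc)
  then show ?thesis
    unfolding quad_eval_def using assms by simp
qed

lemma polar_smult_mat:
  assumes "A \<in> carrier_mat n n" "v \<in> carrier_vec n" "w \<in> carrier_vec n"
  shows "polar (c \<cdot>\<^sub>m A) v w = c * polar A v w"
  using assms by (simp add: polar_def quad_eval_smult_mat[of _ n] algebra_simps)

lemma orth_sum_block:
  "orth_sum A B = four_block_mat A (0\<^sub>m (dim_row A) (dim_col B)) (0\<^sub>m (dim_row B) (dim_col A)) B"
  unfolding orth_sum_def diag_block_mat.simps(2)[of A] diag_block_mat_singleton Let_def ..

lemma orth_sum_eq:
  assumes "A \<in> carrier_mat n n" "B \<in> carrier_mat m m"
  shows "orth_sum A B = four_block_mat A (0\<^sub>m n m) (0\<^sub>m m n) B"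
  using assms by (simp add: orth_sum_block)

lemma orth_sum_carrier [simp]:
  assumes "A \<in> carrier_mat n n" "B \<in> carrier_mat m m"
  shows "orth_sum A B \<in> carrier_mat (n + m) (n + m)"
  using assms by (simp add: orth_sum_eq[OF assms])

lemma dim_row_orth_sum [simp]: "dim_row (orth_sum A B) = dim_row A + dim_row B"
  by (simp add: orth_sum_def dim_diag_block_mat)

lemma quad_eval_orth_sum:
  assumes "A \<in> carrier_mat n n" "B \<in> carrier_mat m m" "v \<in> carrier_vec n" "w \<in> carrier_vec m"
  shows "quad_eval (orth_sum A B) (v @\<^sub>v w) = quad_eval A v + quad_eval B w"
  unfolding quad_eval_def orth_sum_eq[OF assms(1,2)] mult_mat_vec_split[OF assms]
  by (rule scalar_prod_append) (use assms in auto)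

lemma polar_orth_sum:
  assumes "A \<in> carrier_mat n n" "B \<in> carrier_mat m m"
    and "v \<in> carrier_vec n" "w \<in> carrier_vec m" "v' \<in> carrier_vec n" "w' \<in> carrier_vec m"
  shows "polar (orth_sum A B) (v @\<^sub>v w) (v' @\<^sub>v w') = polar A v v' + polar B w w'"
  unfolding polar_def append_vec_add[OF assms(3,5,4,6)]
  using assms by (simp add: quad_eval_orth_sum[of _ n _ m])

lemma polar_zero [simp]:
  assumes "A \<in> carrier_mat n n" "w \<in> carrier_vec n"
  shows "polar A (0\<^sub>v n) w = 0" "polar A w (0\<^sub>v n) = 0"
  using assms by (simp_all add: polar_def)

lemma nonsingular_formD:
  assumes "nonsingular_form A" "A \<in> carrier_mat n n" "v \<in> carrier_vec n"
    and "\<And>w. w \<in> carrier_vec n \<Longrightarrow> polar A v w = 0"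
  shows "v = 0\<^sub>v n"
  using assms by (auto simp: nonsingular_form_def)

lemma nonsingular_orth_sum:
  assumes A: "A \<in> carrier_mat n n" "nonsingular_form A"
    and B: "B \<in> carrier_mat m m" "nonsingular_form B"
  shows "nonsingular_form (orth_sum A B)"
  unfolding nonsingular_form_def
proof (intro ballI impI)
  fix v assume v: "v \<in> carrier_vec (dim_row (orth_sum A B))"
    and z: "\<forall>w\<in>carrier_vec (dim_row (orth_sum A B)). polar (orth_sum A B) v w = 0"
  have d: "dim_row (orth_sum A B) = n + m" using A B by simp
  obtain v1 v2 where s: "v1 \<in> carrier_vec n" "v2 \<in> carrier_vec m" "v = v1 @\<^sub>v v2"
    using v unfolding d by (rule vec_append_cases)
  have z': "polar A v1 w1 + polar B v2 w2 = 0" if "w1 \<in> carrier_vec n" "w2 \<in> carrier_vec m" for w1 w2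
    using z that polar_orth_sum[OF A(1) B(1) s(1,2) that] unfolding d s(3) by simp
  have "v1 = 0\<^sub>v n"
    using z'[of _ "0\<^sub>v m"] B s by (intro nonsingular_formD[OF A(2,1)]) auto
  moreover have "v2 = 0\<^sub>v m"
    using z'[of "0\<^sub>v n"] A s by (intro nonsingular_formD[OF B(2,1)]) auto
  ultimately show "v = 0\<^sub>v (dim_row (orth_sum A B))"
    unfolding d s(3) by (simp add: append_zero_vec)
qed

lemma nonsingular_smult:
  assumes A: "A \<in> carrier_mat n n" "nonsingular_form A" and c: "c \<noteq> 0"
  shows "nonsingular_form (c \<cdot>\<^sub>m A)"
  using A c unfolding nonsingular_form_def by (auto simp: polar_smult_mat[OF A(1)])

lemma ns_orth_sum:
  assumes "A \<in> ns_forms" "B \<in> ns_forms"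
  shows "orth_sum A B \<in> ns_forms"
proof -
  obtain n where A: "A \<in> carrier_mat n n" "even n" "nonsingular_form A"
    using assms(1) by (rule ns_obtain)
  obtain m where B: "B \<in> carrier_mat m m" "even m" "nonsingular_form B"
    using assms(2) by (rule ns_obtain)
  show ?thesis
    by (rule ns_formsI[of _ "n + m"])
       (use A(2) B(2) orth_sum_carrier[OF A(1) B(1)] nonsingular_orth_sum[OF A(1,3) B(1,3)] in auto)
qed

lemma ns_smult:
  assumes "A \<in> ns_forms" "c \<noteq> 0"
  shows "c \<cdot>\<^sub>m A \<in> ns_forms"
proof -
  obtain n where A: "A \<in> carrier_mat n n" "even n" "nonsingular_form A"
    using assms(1) by (rule ns_obtain)
  show ?thesis
    by (rule ns_formsI[of _ n]) (use A nonsingular_smult[OF A(1,3) assms(2)] in auto)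
qed

lemma invertible_if_inj:
  fixes T :: "'a::field mat"
  assumes T: "T \<in> carrier_mat n n"
    and inj: "\<And>v. v \<in> carrier_vec n \<Longrightarrow> T *\<^sub>v v = 0\<^sub>v n \<Longrightarrow> v = 0\<^sub>v n"
  shows "invertible_mat T"
proof -
  have "det T \<noteq> 0" using inj det_0_iff_vec_prod_zero_field[OF T] by auto
  from det_non_zero_imp_unit[OF T this, of "()"] obtain U where "U * T = 1\<^sub>m n" "T * U = 1\<^sub>m n"
    "U \<in> carrier_mat n n" by (auto simp: Units_def ring_mat_def)
  then show ?thesis using T unfolding invertible_mat_def inverts_mat_def by auto
qed

lemma invertible_obtain:
  fixes T :: "'a::field mat"
  assumes "T \<in> carrier_mat n n" "invertible_mat T"
  obtains U where "U \<in> carrier_mat n n" "U * T = 1\<^sub>m n" "T * U = 1\<^sub>m n"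
proof -
  from assms obtain U where U: "T * U = 1\<^sub>m n" "U * T = 1\<^sub>m (dim_row U)"
    unfolding invertible_mat_def inverts_mat_def by auto
  from arg_cong[OF U(1), of dim_col] arg_cong[OF U(2), of dim_col] assms(1)
  have "U \<in> carrier_mat n n" by auto
  with U that show ?thesis by auto
qed

text \<open>A form-preserving map out of a nonsingular form has no kernel, so invertibility is for free.\<close>

lemma isometric_if_preserving:
  assumes A: "A \<in> carrier_mat n n" "nonsingular_form A" and B: "B \<in> carrier_mat n n"
    and T: "T \<in> carrier_mat n n"
    and q: "\<And>v. v \<in> carrier_vec n \<Longrightarrow> quad_eval B (T *\<^sub>v v) = quad_eval A v"
  shows "isometric A B"
proof -
  have "v = 0\<^sub>v n" if v: "v \<in> carrier_vec n" "T *\<^sub>v v = 0\<^sub>v n" for v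
  proof (rule nonsingular_formD[OF A(2,1) v(1)])
    fix w :: "'a vec" assume w: "w \<in> carrier_vec n"
    \<comment> \<open>A map that preserves values preserves the polar form, so a vector of its
      kernel is orthogonal to everything.\<close>
    have "polar A v w = polar B (T *\<^sub>v v) (T *\<^sub>v w)"
      using q[of v] q[of w] q[of "v + w"] v w T
      by (simp add: polar_def mult_add_distrib_mat_vec[OF T v(1) w])
    then show "polar A v w = 0" using B T w by (simp add: v(2))
  qed
  from invertible_if_inj[OF T this] show ?thesis
    unfolding isometric_def using A B T q by auto
qed

lemma isometricE:
  assumes "isometric A B" "A \<in> carrier_mat n n"
  obtains T where "T \<in> carrier_mat n n" "invertible_mat T"
    "\<And>v. v \<in> carrier_vec n \<Longrightarrow> quad_eval B (T *\<^sub>v v) = quad_eval A v"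
  using assms unfolding isometric_def by auto

lemma isometric_dim: "isometric A B \<Longrightarrow> dim_row A = dim_row B"
  by (simp add: isometric_def)

lemma isometric_refl [simp]:
  assumes "A \<in> ns_forms"
  shows "isometric A A"
proof -
  obtain n where A: "A \<in> carrier_mat n n" "even n" "nonsingular_form A"
    using assms by (rule ns_obtain)
  show ?thesis
    by (rule isometric_if_preserving[OF A(1,3,1) one_carrier_mat]) simp
qed

lemma isometric_sym:
  assumes "isometric A B" "A \<in> ns_forms" "B \<in> ns_forms"
  shows "isometric B A"
proof -
  obtain n where A: "A \<in> carrier_mat n n" using assms(2) by (rule ns_obtain)
  have B: "B \<in> carrier_mat n n"
    using isometric_dim[OF assms(1)] A by (intro ns_carrier[OF assms(3)]) simp
  obtain T where T: "T \<in> carrier_mat n n" "invertible_mat T"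
    "\<And>v. v \<in> carrier_vec n \<Longrightarrow> quad_eval B (T *\<^sub>v v) = quad_eval A v"
    using isometricE[OF assms(1) A] by blast
  obtain U where U: "U \<in> carrier_mat n n" "U * T = 1\<^sub>m n" "T * U = 1\<^sub>m n"
    using invertible_obtain[OF T(1,2)] by blast
  show ?thesis
  proof (rule isometric_if_preserving[OF B _ A U(1)])
    fix v :: "'a vec" assume v: "v \<in> carrier_vec n"
    have "T *\<^sub>v (U *\<^sub>v v) = v"
      using assoc_mult_mat_vec[OF T(1) U(1) v] U(3) v by simp
    then show "quad_eval A (U *\<^sub>v v) = quad_eval B v"
      using T(3)[of "U *\<^sub>v v"] U(1) v by simp
  qed (use assms in \<open>auto intro: ns_nonsingular\<close>)
qed

lemma isometric_trans [trans]:
  assumes "isometric A B" "isometric B C" "A \<in> ns_forms" "B \<in> ns_forms" "C \<in> ns_forms"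
  shows "isometric A C"
proof -
  obtain n where A: "A \<in> carrier_mat n n" using assms(3) by (rule ns_obtain)
  have B: "B \<in> carrier_mat n n"
    using isometric_dim[OF assms(1)] A by (intro ns_carrier[OF assms(4)]) simp
  have C: "C \<in> carrier_mat n n"
    using isometric_dim[OF assms(2)] B by (intro ns_carrier[OF assms(5)]) simp
  obtain T where T: "T \<in> carrier_mat n n" "invertible_mat T"
    "\<And>v. v \<in> carrier_vec n \<Longrightarrow> quad_eval B (T *\<^sub>v v) = quad_eval A v"
    using isometricE[OF assms(1) A] by blast
  obtain U where U: "U \<in> carrier_mat n n" "invertible_mat U"
    "\<And>v. v \<in> carrier_vec n \<Longrightarrow> quad_eval C (U *\<^sub>v v) = quad_eval B v"
    using isometricE[OF assms(2) B] by blast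
  show ?thesis
    by (rule isometric_if_preserving[OF A _ C, of "U * T"])
       (use T U assms in \<open>auto intro: ns_nonsingular simp: assoc_mult_mat_vec[OF U(1) T(1)]\<close>)
qed

lemma isometric_orth_sum:
  assumes "isometric A A'" "isometric B B'"
    "A \<in> ns_forms" "A' \<in> ns_forms" "B \<in> ns_forms" "B' \<in> ns_forms"
  shows "isometric (orth_sum A B) (orth_sum A' B')"
proof -
  obtain n where A0: "A \<in> carrier_mat n n" using assms(3) by (rule ns_obtain)
  then have A: "A \<in> carrier_mat n n" "A' \<in> carrier_mat n n"
    using isometric_dim[OF assms(1)] by (auto intro!: ns_carrier[OF assms(4)])
  obtain m where B0: "B \<in> carrier_mat m m" using assms(5) by (rule ns_obtain)
  then have B: "B \<in> carrier_mat m m" "B' \<in> carrier_mat m m"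
    using isometric_dim[OF assms(2)] by (auto intro!: ns_carrier[OF assms(6)])
  obtain T where T: "T \<in> carrier_mat n n"
    "\<And>v. v \<in> carrier_vec n \<Longrightarrow> quad_eval A' (T *\<^sub>v v) = quad_eval A v"
    using isometricE[OF assms(1) A(1)] by blast
  obtain U where U: "U \<in> carrier_mat m m"
    "\<And>v. v \<in> carrier_vec m \<Longrightarrow> quad_eval B' (U *\<^sub>v v) = quad_eval B v"
    using isometricE[OF assms(2) B(1)] by blast
  show ?thesis
  proof (rule isometric_if_preserving[of _ "n + m"])
    show "four_block_mat T (0\<^sub>m n m) (0\<^sub>m m n) U \<in> carrier_mat (n + m) (n + m)"
      using T U by simp
    fix v :: "'a vec" assume "v \<in> carrier_vec (n + m)"
    then obtain v1 v2 where s: "v1 \<in> carrier_vec n" "v2 \<in> carrier_vec m" "v = v1 @\<^sub>v v2"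
      by (rule vec_append_cases)
    show "quad_eval (orth_sum A' B') (four_block_mat T (0\<^sub>m n m) (0\<^sub>m m n) U *\<^sub>v v) = quad_eval (orth_sum A B) v"
      unfolding s(3) mult_mat_vec_split[OF T(1) U(1) s(1,2)]
      using A B s T U by (simp add: quad_eval_orth_sum[of _ n _ m])
  qed (use A B assms in \<open>auto intro!: ns_orth_sum ns_nonsingular\<close>)
qed

lemma isometric_orth_sum_commute:
  assumes "A \<in> ns_forms" "B \<in> ns_forms"
  shows "isometric (orth_sum A B) (orth_sum B A)"
proof -
  obtain n where A: "A \<in> carrier_mat n n" using assms(1) by (rule ns_obtain)
  obtain m where B: "B \<in> carrier_mat m m" using assms(2) by (rule ns_obtain)
  have BA: "orth_sum B A \<in> carrier_mat (n + m) (n + m)"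
    using orth_sum_carrier[OF B A] by (simp add: add.commute)
  show ?thesis
  proof (rule isometric_if_preserving[of _ "n + m"])
    let ?T = "four_block_mat (0\<^sub>m m n) (1\<^sub>m m) (1\<^sub>m n) (0\<^sub>m n m) :: 'a mat"
    show "?T \<in> carrier_mat (n + m) (n + m)" by (rule carrier_matI) simp_all
    fix v :: "'a vec" assume "v \<in> carrier_vec (n + m)"
    then obtain v1 v2 where s: "v1 \<in> carrier_vec n" "v2 \<in> carrier_vec m" "v = v1 @\<^sub>v v2"
      by (rule vec_append_cases)
    have "?T *\<^sub>v v = v2 @\<^sub>v v1"
      unfolding s(3) by (subst four_block_mat_mult_vec[of _ m n _ m _ n]) (use s in auto)
    then show "quad_eval (orth_sum B A) (?T *\<^sub>v v) = quad_eval (orth_sum A B) v"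
      using A B s by (simp add: quad_eval_orth_sum[of _ n _ m] quad_eval_orth_sum[of _ m _ n])
  qed (use A B BA assms in \<open>auto intro!: ns_orth_sum ns_nonsingular\<close>)
qed

lemma orth_sum_assoc: "orth_sum (orth_sum A B) C = orth_sum A (orth_sum B C)"
  using assoc_four_block_mat[of A B C] by (simp add: orth_sum_block)

lemma orth_sum_empty [simp]:
  assumes "A \<in> carrier_mat n n"
  shows "orth_sum A (0\<^sub>m 0 0) = A"
  using assms by (auto simp: orth_sum_eq[OF assms, of _ 0])

lemma ns_empty [simp]: "0\<^sub>m 0 0 \<in> ns_forms"
  by (auto simp: ns_forms_def nonsingular_form_def)

section \<open>Binary forms and hyperbolic planes\<close>

lemma binary_form_carrier [simp]: "binary_form a b \<in> carrier_mat 2 2"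
  by (rule carrier_matI) (simp_all add: binary_form_def mat_of_rows_list_def)

lemma dim_row_binary_form [simp]: "dim_row (binary_form a b) = 2"
  by (simp add: binary_form_def mat_of_rows_list_def)

lemma quad_eval_2:
  assumes "v \<in> carrier_vec 2"
  shows "quad_eval (mat_of_rows_list 2 [[a, e], [0, b]]) v
    = a * (v $ 0)\<^sup>2 + e * (v $ 0 * v $ 1) + b * (v $ 1)\<^sup>2"
proof -
  have "{0..<2::nat} = {0, 1}" by auto
  with assms show ?thesis
    by (auto simp: quad_eval_def mat_of_rows_list_def scalar_prod_def power2_eq_square algebra_simps)
qed

lemma quad_eval_binary:
  assumes "v \<in> carrier_vec 2"
  shows "quad_eval (binary_form a b) v = a * (v $ 0)\<^sup>2 + v $ 0 * v $ 1 + b * (v $ 1)\<^sup>2"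
  using quad_eval_2[OF assms, of a 1 b] by (simp add: binary_form_def)

lemma polar_binary:
  assumes "v \<in> carrier_vec 2" "w \<in> carrier_vec 2"
  shows "polar (binary_form a b) v w
    = 2 * a * v $ 0 * w $ 0 + v $ 0 * w $ 1 + v $ 1 * w $ 0 + 2 * b * v $ 1 * w $ 1"
  using assms by (simp add: polar_def quad_eval_binary power2_eq_square algebra_simps)

lemma vec_2_eqI:
  assumes "v \<in> carrier_vec 2" "w \<in> carrier_vec 2" "v $ 0 = w $ 0" "v $ 1 = w $ 1"
  shows "v = w"
proof (intro eq_vecI)
  fix i assume "i < dim_vec w"
  then have "i = 0 \<or> i = 1" using assms by auto
  then show "v $ i = w $ i" using assms by auto
qed (use assms in auto)

text \<open>The hypotheses hold for all entries in characteristic two, and for the hyperbolic plane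
  over any field. Under them the polar form is \<open>v $ 0 * w $ 1 + v $ 1 * w $ 0\<close>, and
  pairing with the unit vectors reads off both coordinates.\<close>

lemma ns_binary:
  fixes a b :: "'a::field"
  assumes "2 * a = 0" "2 * b = 0"
  shows "binary_form a b \<in> ns_forms"
proof -
  have "v = 0\<^sub>v 2" if v: "v \<in> carrier_vec 2"
    and z: "\<And>w. w \<in> carrier_vec 2 \<Longrightarrow> polar (binary_form a b) v w = 0" for v
    using z[of "unit_vec 2 0"] z[of "unit_vec 2 1"] v assms
    by (intro vec_2_eqI) (auto simp: polar_binary)
  then have "nonsingular_form (binary_form a b)" by (auto simp: nonsingular_form_def)
  then show ?thesis by (intro ns_formsI[OF binary_form_carrier]) auto
qed

lemma hyperbolic_0: "hyperbolic 0 = 0\<^sub>m 0 0"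
  by (simp add: hyperbolic_def)

lemma hyperbolic_Suc: "hyperbolic (Suc m) = orth_sum (binary_form 0 0) (hyperbolic m)"
  by (simp add: hyperbolic_def orth_sum_block Let_def)

lemma ns_hyperbolic [simp]: "hyperbolic m \<in> ns_forms"
  by (induction m) (auto simp: hyperbolic_0 hyperbolic_Suc intro!: ns_orth_sum ns_binary)

lemma dim_row_hyperbolic [simp]: "dim_row (hyperbolic m) = 2 * m"
  by (induction m) (auto simp: hyperbolic_0 hyperbolic_Suc)

lemma hyperbolic_carrier [simp]: "hyperbolic m \<in> carrier_mat (2 * m) (2 * m)"
  by (rule ns_carrier) simp_all

lemma hyperbolic_add: "orth_sum (hyperbolic r) (hyperbolic s) = hyperbolic (r + s)"
  by (simp add: orth_sum_block hyperbolic_def replicate_add diag_block_mat_append Let_def)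

lemma quad_eval_hyperbolic:
  assumes "v \<in> carrier_vec (2 * m)"
  shows "quad_eval (hyperbolic m) v = (\<Sum>i<m. v $ (2 * i) * v $ (2 * i + 1))"
  using assms
proof (induction m arbitrary: v)
  case 0
  then show ?case by (simp add: hyperbolic_0 quad_eval_def scalar_prod_def)
next
  case (Suc m)
  then have "v \<in> carrier_vec (2 + 2 * m)" by simp
  then obtain v1 v2 where s: "v1 \<in> carrier_vec 2" "v2 \<in> carrier_vec (2 * m)" "v = v1 @\<^sub>v v2"
    by (rule vec_append_cases)
  have "quad_eval (hyperbolic (Suc m)) v = v1 $ 0 * v1 $ 1 + (\<Sum>i<m. v2 $ (2 * i) * v2 $ (2 * i + 1))"
    unfolding hyperbolic_Suc s(3) quad_eval_orth_sum[OF binary_form_carrier hyperbolic_carrier s(1,2)]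
    by (simp add: quad_eval_binary[OF s(1)] Suc.IH[OF s(2)])
  also have "\<dots> = (\<Sum>i<Suc m. v $ (2 * i) * v $ (2 * i + 1))"
    unfolding sum.lessThan_Suc_shift using s by auto
  finally show ?case .
qed

text \<open>
  With \<open>q(v) = v\<^sup>T A v\<close> one has \<open>q(v) - q(w) = (v - w) \<bullet> (A\<^sup>T v + A w)\<close>; the coordinates of the two
  factors give the isometry.
\<close>

lemma isometric_hyperbolic:
  fixes A :: "'a::field mat"
  assumes "A \<in> ns_forms"
  shows "isometric (orth_sum A ((-1) \<cdot>\<^sub>m A)) (hyperbolic (dim_row A))"
proof -
  obtain n where A: "A \<in> carrier_mat n n" using assms by (rule ns_obtain)
  define S where "S = orth_sum A ((-1) \<cdot>\<^sub>m A)"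
  have S: "S \<in> carrier_mat (2 * n) (2 * n)" "nonsingular_form S"
    using orth_sum_carrier[OF A, of "(-1) \<cdot>\<^sub>m A" n] A ns_orth_sum[OF assms ns_smult[OF assms, of "-1"]]
    by (auto simp: S_def mult_2 intro!: ns_nonsingular)
  \<comment> \<open>Row \<open>2 * i\<close> of the matrix yields the i-th coordinate of
    \<open>v1 - v2\<close>, row \<open>2 * i + 1\<close> that of \<open>A^T v1 + A v2\<close>. The
    two kinds alternate because \<open>hyperbolic n\<close> pairs neighbouring coordinates.\<close>
  define r where "r k = (if even k then unit_vec n (k div 2) @\<^sub>v (- unit_vec n (k div 2))
     else col A (k div 2) @\<^sub>v row A (k div 2))" for k :: nat
  define T where "T = mat (2 * n) (2 * n) (\<lambda>(k, j). r k $ j)"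
  have T: "T \<in> carrier_mat (2 * n) (2 * n)" by (simp add: T_def)
  have "isometric S (hyperbolic n)"
  proof (rule isometric_if_preserving[OF S hyperbolic_carrier T])
    fix v :: "'a vec" assume v': "v \<in> carrier_vec (2 * n)"
    then have "v \<in> carrier_vec (n + n)" by (simp add: mult_2)
    then obtain v1 v2 where s: "v1 \<in> carrier_vec n" "v2 \<in> carrier_vec n" "v = v1 @\<^sub>v v2"
      by (rule vec_append_cases)
    have row: "row T k = r k" if "k < 2 * n" for k
      using that A by (intro eq_vecI) (auto simp: T_def r_def)
    have e: "(T *\<^sub>v v) $ (2 * i) = v1 $ i - v2 $ i" if "i < n" for i
      using that T s v' A
      by (simp add: row r_def scalar_prod_append[of _ n _ n])
    have o: "(T *\<^sub>v v) $ (2 * i + 1) = (\<Sum>j<n. A $$ (j, i) * v1 $ j) + (\<Sum>j<n. A $$ (i, j) * v2 $ j)"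
      if "i < n" for i
    proof -
      have "(T *\<^sub>v v) $ (2 * i + 1) = col A i \<bullet> v1 + row A i \<bullet> v2"
        using that T s v' A by (simp add: row r_def scalar_prod_append[of _ n _ n])
      then show ?thesis using that s A by (simp add: scalar_prod_def lessThan_atLeast0)
    qed
    have q: "quad_eval A w = (\<Sum>i<n. \<Sum>j<n. w $ i * A $$ (i, j) * w $ j)" if "w \<in> carrier_vec n" for w
      using that A by (simp add: quad_eval_def scalar_prod_def sum_distrib_left mult.assoc lessThan_atLeast0)
    have "quad_eval (hyperbolic n) (T *\<^sub>v v) = (\<Sum>i<n. (v1 $ i - v2 $ i) *
       ((\<Sum>j<n. A $$ (j, i) * v1 $ j) + (\<Sum>j<n. A $$ (i, j) * v2 $ j)))"
      using T v' unfolding quad_eval_hyperbolic[OF mult_mat_vec_carrier[OF T v']]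
      by (intro sum.cong refl) (simp only: e o lessThan_iff)
    also have "\<dots> = (\<Sum>i<n. \<Sum>j<n. v1 $ i * A $$ (j, i) * v1 $ j) - (\<Sum>i<n. \<Sum>j<n. v2 $ i * A $$ (j, i) * v1 $ j)
      + (\<Sum>i<n. \<Sum>j<n. v1 $ i * A $$ (i, j) * v2 $ j) - (\<Sum>i<n. \<Sum>j<n. v2 $ i * A $$ (i, j) * v2 $ j)"
      by (simp add: sum_distrib_left sum.distrib sum_subtractf algebra_simps)
    \<comment> \<open>Exchanging the summation indices makes the two cross terms equal, so they
      cancel in every characteristic.\<close>
    also have "(\<Sum>i<n. \<Sum>j<n. v2 $ i * A $$ (j, i) * v1 $ j) = (\<Sum>i<n. \<Sum>j<n. v1 $ i * A $$ (i, j) * v2 $ j)"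
      by (subst sum.swap) (simp add: mult_ac)
    also have "(\<Sum>i<n. \<Sum>j<n. v1 $ i * A $$ (j, i) * v1 $ j) = (\<Sum>i<n. \<Sum>j<n. v1 $ i * A $$ (i, j) * v1 $ j)"
      by (subst sum.swap) (simp add: mult_ac)
    also have "\<dots> - (\<Sum>i<n. \<Sum>j<n. v1 $ i * A $$ (i, j) * v2 $ j) + (\<Sum>i<n. \<Sum>j<n. v1 $ i * A $$ (i, j) * v2 $ j)
       - (\<Sum>i<n. \<Sum>j<n. v2 $ i * A $$ (i, j) * v2 $ j) = quad_eval A v1 - quad_eval A v2"
      using s by (simp add: q)
    also have "\<dots> = quad_eval S v"
      unfolding S_def s(3) using A s
      by (simp add: quad_eval_orth_sum[of _ n _ n] quad_eval_smult_mat[of _ n])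
    finally show "quad_eval (hyperbolic n) (T *\<^sub>v v) = quad_eval S v" .
  qed
  then show ?thesis using A by (simp add: S_def)
qed

section \<open>The Witt group\<close>

lemma isometric_stabilize:
  assumes "isometric (orth_sum A (hyperbolic r)) (orth_sum B (hyperbolic s))"
    and "A \<in> ns_forms" "B \<in> ns_forms"
  shows "isometric (orth_sum A (hyperbolic (r + t))) (orth_sum B (hyperbolic (s + t)))"
  using isometric_orth_sum[OF assms(1) isometric_refl[OF ns_hyperbolic[of t]]] assms
  by (simp add: ns_orth_sum orth_sum_assoc hyperbolic_add)

lemma witt_equivalent_if_isometric:
  assumes "isometric A B" "A \<in> ns_forms" "B \<in> ns_forms"
  shows "witt_equivalent A B"
  unfolding witt_equivalent_def
  using isometric_orth_sum[OF assms(1) isometric_refl[OF ns_hyperbolic[of 0]]] assms by auto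

lemma witt_equivalent_refl [simp]: "A \<in> ns_forms \<Longrightarrow> witt_equivalent A A"
  by (simp add: witt_equivalent_if_isometric)

lemma witt_equivalent_sym:
  "witt_equivalent A B \<Longrightarrow> A \<in> ns_forms \<Longrightarrow> B \<in> ns_forms \<Longrightarrow> witt_equivalent B A"
  unfolding witt_equivalent_def by (meson isometric_sym ns_hyperbolic ns_orth_sum)

lemma witt_equivalent_trans:
  assumes "witt_equivalent A B" "witt_equivalent B C" "A \<in> ns_forms" "B \<in> ns_forms" "C \<in> ns_forms"
  shows "witt_equivalent A C"
proof -
  obtain r s where 1: "isometric (orth_sum A (hyperbolic r)) (orth_sum B (hyperbolic s))"
    using assms(1) by (auto simp: witt_equivalent_def)
  obtain r' s' where 2: "isometric (orth_sum B (hyperbolic r')) (orth_sum C (hyperbolic s'))"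
    using assms(2) by (auto simp: witt_equivalent_def)
  \<comment> \<open>Both isometries are stabilized until \<open>B\<close> is accompanied by
    \<open>s + r'\<close> planes in each.\<close>
  have "isometric (orth_sum A (hyperbolic (r + r'))) (orth_sum B (hyperbolic (s + r')))"
    by (rule isometric_stabilize[OF 1 assms(3,4)])
  also have "isometric \<dots> (orth_sum C (hyperbolic (s' + s)))"
    using isometric_stabilize[OF 2 assms(4,5), of s] by (simp add: add.commute)
  finally show ?thesis
    unfolding witt_equivalent_def using assms by (auto simp: ns_orth_sum)
qed

lemma witt_equivalent_orth_sum:
  assumes "witt_equivalent A A'" "witt_equivalent B B'"
    and ns: "A \<in> ns_forms" "A' \<in> ns_forms" "B \<in> ns_forms" "B' \<in> ns_forms"
  shows "witt_equivalent (orth_sum A B) (orth_sum A' B')"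
proof -
  \<comment> \<open>Orthogonal sums commute up to isometry, so planes added to the whole can be
    distributed over the two summands.\<close>
  have shuffle: "isometric (orth_sum (orth_sum X Y) (hyperbolic (r + s)))
      (orth_sum (orth_sum X (hyperbolic r)) (orth_sum Y (hyperbolic s)))"
    if "X \<in> ns_forms" "Y \<in> ns_forms" for X Y :: "'a mat" and r s
  proof -
    have "isometric (orth_sum X (orth_sum (orth_sum Y (hyperbolic r)) (hyperbolic s)))
       (orth_sum X (orth_sum (orth_sum (hyperbolic r) Y) (hyperbolic s)))"
      using that
      by (intro isometric_orth_sum[OF isometric_refl isometric_orth_sum[OF isometric_orth_sum_commute isometric_refl]]
          ns_orth_sum ns_hyperbolic)
    then show ?thesis by (simp add: orth_sum_assoc hyperbolic_add)
  qed
  obtain r s where 1: "isometric (orth_sum A (hyperbolic r)) (orth_sum A' (hyperbolic s))"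
    using assms(1) by (auto simp: witt_equivalent_def)
  obtain r' s' where 2: "isometric (orth_sum B (hyperbolic r')) (orth_sum B' (hyperbolic s'))"
    using assms(2) by (auto simp: witt_equivalent_def)
  note [simp] = ns ns_orth_sum
  note shuffle[OF ns(1,3), of r r']
  also have "isometric (orth_sum (orth_sum A (hyperbolic r)) (orth_sum B (hyperbolic r')))
      (orth_sum (orth_sum A' (hyperbolic s)) (orth_sum B' (hyperbolic s')))"
    by (intro isometric_orth_sum[OF 1 2] ns_orth_sum ns ns_hyperbolic)
  also have "isometric \<dots> (orth_sum (orth_sum A' B') (hyperbolic (s + s')))"
    by (intro isometric_sym[OF shuffle] ns_orth_sum ns ns_hyperbolic)
  finally show ?thesis unfolding witt_equivalent_def by auto
qed

lemma witt_class_eq_iff: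
  assumes "A \<in> ns_forms" "B \<in> ns_forms"
  shows "witt_class A = witt_class B \<longleftrightarrow> witt_equivalent A B"
  using assms witt_equivalent_sym witt_equivalent_trans witt_equivalent_refl
  unfolding witt_class_def by (smt (verit, best) Collect_cong mem_Collect_eq)

text \<open>The product in \<open>Iq1\<close> is a union over all pairs of representatives. Witt
  equivalence is a congruence, so every member of the union is the same class, and the index sets
  are nonempty.\<close>

lemma Iq1_mult:
  assumes "A \<in> ns_forms" "B \<in> ns_forms"
  shows "witt_class A \<otimes>\<^bsub>Iq1\<^esub> witt_class B = witt_class (orth_sum A B)"
proof -
  have "witt_class (orth_sum A' B') = witt_class (orth_sum A B)"
    if "A' \<in> witt_class A" "B' \<in> witt_class B" for A' B'
    using that assms
    by (subst witt_class_eq_iff)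
       (simp_all add: witt_class_def ns_orth_sum witt_equivalent_orth_sum witt_equivalent_sym)
  then have "(\<Union>A'\<in>witt_class A. \<Union>B'\<in>witt_class B. witt_class (orth_sum A' B'))
    = (\<Union>A'\<in>witt_class A. \<Union>B'\<in>witt_class B. witt_class (orth_sum A B))"
    by (intro SUP_cong refl)
  moreover have "A \<in> witt_class A" "B \<in> witt_class B" using assms by (auto simp: witt_class_def)
  ultimately show ?thesis unfolding Iq1_def by auto
qed

section \<open>Witt classes as an additive group\<close>

typedef (overloaded) 'a witt = "witt_class ` (ns_forms :: 'a::field mat set)"
  using ns_empty by blast

definition of_form :: "'a::field mat \<Rightarrow> 'a witt" where
  "of_form A = Abs_witt (witt_class A)"

lemma Rep_of_form: "A \<in> ns_forms \<Longrightarrow> Rep_witt (of_form A) = witt_class A"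
  by (simp add: of_form_def Abs_witt_inverse)

lemma of_form_cases:
  obtains A where "A \<in> ns_forms" "x = of_form A"
  using Rep_witt[of x] by (auto simp: of_form_def) (metis Rep_witt_inverse)

lemma of_form_eq_iff:
  "A \<in> ns_forms \<Longrightarrow> B \<in> ns_forms \<Longrightarrow> of_form A = of_form B \<longleftrightarrow> witt_equivalent A B"
  using Rep_of_form witt_class_eq_iff by (metis Rep_witt_inject)

lemma of_form_isometric:
  "isometric A B \<Longrightarrow> A \<in> ns_forms \<Longrightarrow> B \<in> ns_forms \<Longrightarrow> of_form A = of_form B"
  by (simp add: of_form_eq_iff witt_equivalent_if_isometric)

text \<open>This makes finite sums and cancellation available for Witt classes;
  \<open>Rep_witt\<close> carries the results back to the group \<open>Iq1\<close>.\<close>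

instantiation witt :: (field) ab_group_add
begin

definition "0 = of_form (0\<^sub>m 0 0)"
definition "x + y = Abs_witt (Rep_witt x \<otimes>\<^bsub>Iq1\<^esub> Rep_witt y)"
text \<open>An arbitrary representative may be taken, because the law \<open>- x + x = 0\<close>
  determines the result.\<close>

definition "- x = of_form ((-1) \<cdot>\<^sub>m (SOME A. A \<in> ns_forms \<and> x = of_form A))"
definition "x - y = x + - (y :: 'a witt)"

lemma of_form_orth_sum:
  "A \<in> ns_forms \<Longrightarrow> B \<in> ns_forms \<Longrightarrow> of_form (orth_sum A B) = of_form A + of_form B"
  by (simp add: plus_witt_def Rep_of_form Iq1_mult) (simp add: of_form_def)

lemma of_form_hyperbolic: "of_form (hyperbolic m) = 0"
  unfolding zero_witt_def
proof (subst of_form_eq_iff)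
  have "isometric (orth_sum (hyperbolic m) (hyperbolic 0)) (orth_sum (hyperbolic 0) (hyperbolic m))"
    by (simp add: hyperbolic_add)
  then show "witt_equivalent (hyperbolic m) (0\<^sub>m 0 0)"
    unfolding witt_equivalent_def hyperbolic_0 by (metis hyperbolic_0)
qed simp_all

instance
proof
  fix x y z :: "'a witt"
  obtain A where A: "A \<in> ns_forms" "x = of_form A" by (rule of_form_cases)
  obtain B where B: "B \<in> ns_forms" "y = of_form B" by (rule of_form_cases)
  obtain C where C: "C \<in> ns_forms" "z = of_form C" by (rule of_form_cases)
  show "x + y + z = x + (y + z)"
    unfolding A B C by (simp flip: of_form_orth_sum add: A B C ns_orth_sum orth_sum_assoc)
  show comm: "x + y = y + x"
    unfolding A B by (simp flip: of_form_orth_sum add: A B ns_orth_sum)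
      (intro of_form_isometric isometric_orth_sum_commute ns_orth_sum A B)
  have "x + 0 = x"
    unfolding A zero_witt_def
    by (simp flip: of_form_orth_sum add: A orth_sum_empty[OF ns_carrier[OF A(1) refl]])
  moreover have "x + 0 = 0 + x"
    unfolding A zero_witt_def by (simp flip: of_form_orth_sum add: A ns_orth_sum)
      (intro of_form_isometric isometric_orth_sum_commute ns_orth_sum A ns_empty)
  ultimately show "0 + x = x" by simp
  define D where "D = (SOME A. A \<in> ns_forms \<and> x = of_form A)"
  have D: "D \<in> ns_forms" "x = of_form D" using someI[of "\<lambda>A. A \<in> ns_forms \<and> x = of_form A"] A
    unfolding D_def by auto
  have "- x + x = of_form (orth_sum ((-1) \<cdot>\<^sub>m D) D)"
    unfolding uminus_witt_def D_def[symmetric] using D by (simp add: of_form_orth_sum ns_smult)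
  also have "\<dots> = of_form (orth_sum D ((-1) \<cdot>\<^sub>m D))"
    by (intro of_form_isometric isometric_orth_sum_commute ns_orth_sum ns_smult D) auto
  also have "\<dots> = 0"
    using of_form_isometric[OF isometric_hyperbolic[OF D(1)]] D
    by (simp add: of_form_hyperbolic ns_orth_sum ns_smult)
  finally show "- x + x = 0" .
  show "x - y = x + - y" by (simp add: minus_witt_def)
qed

end

lemma Iq1_carrier: "carrier Iq1 = range Rep_witt"
  by (simp add: Iq1_def type_definition.Rep_range[OF type_definition_witt])

lemma Iq1_mult_Rep: "Rep_witt x \<otimes>\<^bsub>Iq1\<^esub> Rep_witt y = Rep_witt (x + y)"
proof -
  obtain A where A: "A \<in> ns_forms" "x = of_form A" by (rule of_form_cases)
  obtain B where B: "B \<in> ns_forms" "y = of_form B" by (rule of_form_cases)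
  show ?thesis
    unfolding A B by (simp flip: of_form_orth_sum add: A B ns_orth_sum Rep_of_form Iq1_mult)
qed

lemma Iq1_one: "\<one>\<^bsub>Iq1\<^esub> = Rep_witt 0"
  by (simp add: Iq1_def zero_witt_def Rep_of_form)

lemma Iq1_comm_group: "comm_group Iq1"
proof (rule comm_groupI)
  fix x assume "x \<in> carrier Iq1"
  then obtain w where w: "x = Rep_witt w" by (auto simp: Iq1_carrier)
  then show "\<exists>y\<in>carrier Iq1. y \<otimes>\<^bsub>Iq1\<^esub> x = \<one>\<^bsub>Iq1\<^esub>"
    by (intro bexI[of _ "Rep_witt (- w)"]) (simp_all add: Iq1_mult_Rep Iq1_one Iq1_carrier)
qed (auto simp: Iq1_carrier Iq1_mult_Rep Iq1_one add_ac)

lemma Iq1_inv: "inv\<^bsub>Iq1\<^esub> (Rep_witt x) = Rep_witt (- x)"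
proof -
  interpret comm_group Iq1 by (rule Iq1_comm_group)
  show ?thesis by (rule inv_equality) (simp_all add: Iq1_mult_Rep Iq1_one Iq1_carrier)
qed

text \<open>Reduces strong tightness to finding a suitable subgroup \<open>H\<close> of the additive
  group of Witt classes. Generating inside \<open>Iq n\<close> or inside \<open>Iq1\<close> gives
  the same set, because the classes of \<open>S\<close> lie in the subgroup
  \<open>Iq n\<close>.\<close>

lemma generate_Iq_subset:
  fixes S :: "'a::field mat set"
  assumes S: "S \<subseteq> quadratic_pfister_forms n"
    and ns: "quadratic_pfister_forms n \<subseteq> (ns_forms :: 'a mat set)"
    and H: "0 \<in> H" "\<And>x y. x \<in> H \<Longrightarrow> y \<in> H \<Longrightarrow> x + y \<in> H" "\<And>x. x \<in> H \<Longrightarrow> - x \<in> H"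
      "of_form ` S \<subseteq> H"
  shows "generate (Iq n) (witt_class ` S) \<subseteq> Rep_witt ` (H :: 'a witt set)"
proof -
  interpret comm_group "Iq1 :: 'a mat set monoid" by (rule Iq1_comm_group)
  have S_ns: "S \<subseteq> ns_forms" using S ns by blast
  define K where "K = {witt_class (c \<cdot>\<^sub>m P) | c P. c \<noteq> 0 \<and> P \<in> (quadratic_pfister_forms n :: 'a mat set)}"
  have K: "K \<subseteq> carrier (Iq1 :: 'a mat set monoid)"
    using ns by (auto simp: K_def Iq1_def intro!: ns_smult)
  have "witt_class ` S \<subseteq> K"
  proof
    fix X assume "X \<in> witt_class ` S"
    then obtain P where P: "P \<in> S" "X = witt_class P" by blast
    have "1 \<cdot>\<^sub>m P = P" by (intro eq_matI) auto
    with P S show "X \<in> K" unfolding K_def mem_Collect_eq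
      by (intro exI[of _ 1] exI[of _ P]) auto
  qed
  then have sub: "witt_class ` S \<subseteq> generate Iq1 K" by (auto intro: generate.incl)
  have "generate (Iq n) (witt_class ` S) = generate Iq1 (witt_class ` S)"
    unfolding Iq_def K_def[symmetric]
    by (rule generate_consistent[OF sub generate_is_subgroup[OF K]])
  also have "\<dots> \<subseteq> Rep_witt ` H"
  proof
    have in_H: "X \<in> Rep_witt ` H" if "X \<in> witt_class ` S" for X
      using that S_ns H(4) by (force simp flip: Rep_of_form)
    fix X :: "'a mat set" assume "X \<in> generate Iq1 (witt_class ` S)"
    then show "X \<in> Rep_witt ` H"
    proof induction
      case one
      show ?case using H by (simp add: Iq1_one)
    next
      case (incl X)
      then show ?case by (rule in_H)
    next
      case (inv X)
      then show ?case using in_H[OF inv] H by (auto simp: Iq1_inv)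
    next
      case (eng X Y)
      then show ?case using H by (auto simp: Iq1_mult_Rep)
    qed
  qed
  finally show ?thesis .
qed

section \<open>Quadratic Pfister forms\<close>

lemma dim_tensor [simp]:
  "dim_row (tensor B A) = dim_row B * dim_row A" "dim_col (tensor B A) = dim_col B * dim_col A"
  by (simp_all add: tensor_def)

lemma index_tensor:
  "i < dim_row B * dim_row A \<Longrightarrow> j < dim_col B * dim_col A \<Longrightarrow> tensor B A $$ (i, j)
    = B $$ (i div dim_row A, j div dim_col A) * A $$ (i mod dim_row A, j mod dim_col A)"
  by (simp add: tensor_def)

lemma div_mod_mult_nat: "i mod (b * c) div c = i div c mod (b :: nat)" "i mod (b * c) mod c = i mod c"
  by (cases "c = 0"; simp add: mod_mult2_eq mult.commute[of b c] mod_mod_cancel)+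

text \<open>Makes the first bilinear slot of a Pfister form the outermost factor, both for the
  recursion on the slots and for right linkage.\<close>

lemma tensor_assoc: "tensor (tensor C B) A = tensor C (tensor B A)"
proof (rule eq_matI; simp add: mult.assoc)
  fix i j assume i: "i < dim_row C * (dim_row B * dim_row A)" and j: "j < dim_col C * (dim_col B * dim_col A)"
  let ?a = "dim_row A" and ?b = "dim_row B" and ?a' = "dim_col A" and ?b' = "dim_col B"
  have pos: "?a > 0" "?b > 0" "?a' > 0" "?b' > 0"
    using i j by (auto intro!: Nat.gr0I)
  have "i div ?a < dim_row C * ?b" "j div ?a' < dim_col C * ?b'"
    using i j by (auto intro!: less_mult_imp_div_less simp: mult.assoc)
  then show "tensor (tensor C B) A $$ (i, j) = tensor C (tensor B A) $$ (i, j)"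
    using i j pos by (simp add: index_tensor mult.assoc div_mult2_eq[symmetric] div_mod_mult_nat
        mult.commute[of ?a] mult.commute[of ?a'])
qed

lemma tensor_one:
  assumes "A \<in> carrier_mat n n"
  shows "tensor (1\<^sub>m 1) A = A"
  using assms by (intro eq_matI) (auto simp: index_tensor)

lemma tensor_bpfister1:
  assumes A: "A \<in> carrier_mat n n"
  shows "tensor (bpfister1 b) A = orth_sum A (b \<cdot>\<^sub>m A)"
proof (rule eq_matI)
  have d: "dim_row A = n" "dim_col A = n" "dim_row (bpfister1 b) = 2" "dim_col (bpfister1 b) = 2"
    using A by (auto simp: bpfister1_def mat_of_rows_list_def)
  fix i j assume "i < dim_row (orth_sum A (b \<cdot>\<^sub>m A))" "j < dim_col (orth_sum A (b \<cdot>\<^sub>m A))"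
  then have ij: "i < 2 * n" "j < 2 * n" using d by (auto simp: orth_sum_block)
  have q: "k div n = (if k < n then 0 else 1)" "k mod n = (if k < n then k else k - n)" if "k < 2 * n" for k
    using that by (auto simp: div_nat_eqI le_mod_geq mod_if)
  show "tensor (bpfister1 b) A $$ (i, j) = orth_sum A (b \<cdot>\<^sub>m A) $$ (i, j)"
    using ij d by (auto simp: index_tensor orth_sum_block q bpfister1_def mat_of_rows_list_def)
qed (use A in \<open>auto simp: bpfister1_def mat_of_rows_list_def orth_sum_block\<close>)

definition qpfister :: "'a::field list \<Rightarrow> 'a \<Rightarrow> 'a mat" where
  "qpfister bs a = tensor (bpfister bs) (qpfister1 a)"

lemma qpfister_carrier [simp]:
  "qpfister bs a \<in> carrier_mat (2 ^ Suc (length bs)) (2 ^ Suc (length bs))"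
proof -
  have "dim_row (bpfister bs) = 2 ^ length bs \<and> dim_col (bpfister bs) = 2 ^ length bs"
    by (induction bs) (auto simp: bpfister1_def mat_of_rows_list_def)
  moreover have "dim_row (qpfister1 a) = 2 \<and> dim_col (qpfister1 a) = 2"
    by (simp add: qpfister1_def binary_form_def mat_of_rows_list_def)
  ultimately show ?thesis by (auto simp: qpfister_def intro!: carrier_matI)
qed

lemma qpfister_Nil: "qpfister [] a = binary_form 1 a"
  using tensor_one[OF binary_form_carrier] by (simp add: qpfister_def qpfister1_def)

text \<open>This recursion replaces the Kronecker product: inductions over the slots only see a form
  plus a scalar multiple of it.\<close>

lemma qpfister_Cons: "qpfister (b # bs) a = orth_sum (qpfister bs a) (b \<cdot>\<^sub>m qpfister bs a)"
  using tensor_bpfister1[OF qpfister_carrier] by (simp add: qpfister_def tensor_assoc)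

lemma qpfister_ns:
  assumes "(2::'a::field) = 0" "0 \<notin> set bs"
  shows "qpfister bs (a::'a) \<in> ns_forms"
  using assms(2)
  by (induction bs) (auto simp: qpfister_Nil qpfister_Cons assms(1) intro!: ns_binary ns_orth_sum ns_smult)

lemma quadratic_pfister_forms_eq:
  "quadratic_pfister_forms n = {qpfister bs a | bs a. length bs = n - 1 \<and> 0 \<notin> set bs}"
  by (simp add: quadratic_pfister_forms_def qpfister_def)

section \<open>Witt classes of binary forms in characteristic two\<close>

definition bin_class :: "'a::field \<Rightarrow> 'a \<Rightarrow> 'a witt" where
  "bin_class a b = of_form (binary_form a b)"

lemma double_eq_0: "(2::'a::field) = 0 \<Longrightarrow> x + x = (0::'a)"
  by (metis mult_2 mult_zero_left)

lemma vCons_2_carrier [simp]: "vCons x (vCons y vNil) \<in> carrier_vec 2"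
  by (rule carrier_vecI) simp

lemma isometric_planes:
  fixes A B :: "'a::field mat"
  assumes A: "A \<in> carrier_mat 2 2" "A \<in> ns_forms" and B: "B \<in> carrier_mat 2 2"
    and q: "\<And>v. v \<in> carrier_vec 2 \<Longrightarrow>
      quad_eval B (vCons (p * v $ 0 + q * v $ 1) (vCons (r * v $ 0 + s * v $ 1) vNil)) = quad_eval A v"
  shows "isometric A B"
proof (rule isometric_if_preserving[OF A(1) ns_nonsingular[OF A(2)] B])
  let ?T = "mat_of_rows_list 2 [[p, q], [r, s]]"
  show T: "?T \<in> carrier_mat 2 2" by (rule carrier_matI) (simp_all add: mat_of_rows_list_def)
  fix v :: "'a vec" assume v: "v \<in> carrier_vec 2"
  have "{0..<2::nat} = {0, 1}" by auto
  then have "?T *\<^sub>v v = vCons (p * v $ 0 + q * v $ 1) (vCons (r * v $ 0 + s * v $ 1) vNil)"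
    using v by (intro vec_2_eqI mult_mat_vec_carrier[OF T v] vCons_2_carrier)
      (simp_all add: mat_of_rows_list_def scalar_prod_def)
  then show "quad_eval B (?T *\<^sub>v v) = quad_eval A v" using q[OF v] by simp
qed

text \<open>A linear substitution with coefficients p, q, r, s. Nonsingularity of the source form
  already makes it invertible, so an equality of classes becomes a polynomial identity.\<close>

lemma bin_class_eqI:
  fixes a b a' b' :: "'a::field"
  assumes two: "(2::'a) = 0"
    and "\<And>x y. a' * (p * x + q * y)\<^sup>2 + (p * x + q * y) * (r * x + s * y) + b' * (r * x + s * y)\<^sup>2
      = a * x\<^sup>2 + x * y + b * y\<^sup>2"
  shows "bin_class a b = bin_class a' b'"
  unfolding bin_class_def using assms
  by (intro of_form_isometric isometric_planes[of _ _ p q r s] ns_binary)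
     (auto simp: quad_eval_binary)

lemma bin_class_commute: "(2::'a::field) = 0 \<Longrightarrow> bin_class a b = bin_class b (a::'a)"
  by (rule bin_class_eqI[of _ 0 1 1 0]) (auto simp: algebra_simps)

lemma bin_class_00: "bin_class 0 0 = 0"
proof -
  have "hyperbolic (Suc 0) = binary_form 0 0"
    by (simp add: hyperbolic_Suc hyperbolic_0 orth_sum_empty[OF binary_form_carrier])
  then show ?thesis unfolding bin_class_def by (metis of_form_hyperbolic)
qed

text \<open>Let e1, f1 and e2, f2 be the bases of [a, b] and [a, c]. Then e1 and f1 + f2 span
  [a, b + c], and the complement is the hyperbolic plane spanned by f2 + c (e1 + e2) and e1 + e2.
  The matrix in the proof takes coordinates in this basis.\<close>

lemma bin_class_add_right:
  fixes a b c :: "'a::field"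
  assumes two: "(2::'a) = 0"
  shows "bin_class a (b + c) = bin_class a b + bin_class a c"
proof -
  have ns: "binary_form x y \<in> ns_forms" for x y :: 'a using two by (simp add: ns_binary)
  have "isometric (orth_sum (binary_form a b) (binary_form a c)) (orth_sum (binary_form a (b + c)) (binary_form 0 0))"
  proof (rule isometric_if_preserving[of _ 4])
    let ?T = "mat_of_rows_list 4 [[1, 0, 1, 0], [0, 1, 0, 0], [0, 1, 0, 1], [0, c, 1, c]]"
    show "?T \<in> carrier_mat 4 4" by (rule carrier_matI) (simp_all add: mat_of_rows_list_def)
    fix v :: "'a vec" assume "v \<in> carrier_vec 4"
    then have "v \<in> carrier_vec (2 + 2)" by simp
    then obtain v1 v2 where s: "v1 \<in> carrier_vec 2" "v2 \<in> carrier_vec 2" "v = v1 @\<^sub>v v2"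
      by (rule vec_append_cases)
    define w1 where "w1 = vCons (v1 $ 0 + v2 $ 0) (vCons (v1 $ 1) vNil)"
    define w2 where "w2 = vCons (v1 $ 1 + v2 $ 1) (vCons (v2 $ 0 + c * (v1 $ 1 + v2 $ 1)) vNil)"
    have w: "w1 \<in> carrier_vec 2" "w2 \<in> carrier_vec 2" by (simp_all add: w1_def w2_def)
    have "{0..<4::nat} = {0, 1, 2, 3}" by auto
    then have sc: "x \<bullet> v = x $ 0 * v1 $ 0 + x $ 1 * v1 $ 1 + x $ 2 * v2 $ 0 + x $ 3 * v2 $ 1" for x
      using s by (simp add: scalar_prod_def add.assoc)
    have "?T *\<^sub>v v = w1 @\<^sub>v w2"
    proof (rule eq_vecI)
      fix i assume "i < dim_vec (w1 @\<^sub>v w2)"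
      then have "i < 4" using w by simp
      then have "i = 0 \<or> i = 1 \<or> i = 2 \<or> i = 3" by linarith
      then show "(?T *\<^sub>v v) $ i = (w1 @\<^sub>v w2) $ i"
        using w by (auto simp: mat_of_rows_list_def sc w1_def w2_def algebra_simps numeral_2_eq_2 numeral_3_eq_3)
    qed (use w in \<open>auto simp: mat_of_rows_list_def\<close>)
    \<comment> \<open>The identity holds over any field once the defect is collected in a multiple
      of 2.\<close>
    moreover have "quad_eval (orth_sum (binary_form a (b + c)) (binary_form 0 0)) (w1 @\<^sub>v w2)
      = quad_eval (orth_sum (binary_form a b) (binary_form a c)) v
        + 2 * (a * v1 $ 0 * v2 $ 0 + v2 $ 0 * v1 $ 1 + c * (v1 $ 1)\<^sup>2 + c * v1 $ 1 * v2 $ 1)"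
      unfolding s(3) quad_eval_orth_sum[OF binary_form_carrier binary_form_carrier w]
        quad_eval_orth_sum[OF binary_form_carrier binary_form_carrier s(1,2)]
        quad_eval_binary[OF w(1)] quad_eval_binary[OF w(2)] quad_eval_binary[OF s(1)] quad_eval_binary[OF s(2)]
      by (simp add: w1_def w2_def power2_eq_square algebra_simps)
    ultimately show "quad_eval (orth_sum (binary_form a (b + c)) (binary_form 0 0)) (?T *\<^sub>v v)
      = quad_eval (orth_sum (binary_form a b) (binary_form a c)) v"
      using two by simp
  qed (use orth_sum_carrier[OF binary_form_carrier binary_form_carrier] in
      \<open>auto intro!: ns_nonsingular ns_orth_sum ns\<close>)
  then have "bin_class a b + bin_class a c = bin_class a (b + c) + bin_class 0 0"
    unfolding bin_class_def by (simp flip: of_form_orth_sum add: ns ns_orth_sum of_form_isometric)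
  then show ?thesis by (simp add: bin_class_00)
qed

lemma bin_class_0:
  assumes "(2::'a::field) = 0"
  shows "bin_class a 0 = 0" "bin_class 0 (a::'a) = 0"
  using bin_class_add_right[OF assms, of a 0 0] by (simp_all add: bin_class_commute[OF assms, of 0 a])

text \<open>For nonzero \<open>c\<close>, the two variables are rescaled by c and 1 / c.\<close>

lemma bin_class_square:
  assumes "(2::'a::field) = 0"
  shows "bin_class (a * c\<^sup>2) b = bin_class a (b * (c::'a)\<^sup>2)"
proof (cases "c = 0")
  case False
  then show ?thesis
    by (intro bin_class_eqI[OF assms, of _ c 0 0 "1 / c"]) (auto simp: field_simps power2_eq_square)
qed (simp add: bin_class_0[OF assms])

text \<open>Replacing x by x + t y carries [a, 0] to this form. For a = 1 the second entries are the
  Artin-Schreier elements t + t^2.\<close>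

lemma bin_class_artin_schreier:
  fixes a t :: "'a::field"
  assumes "(2::'a) = 0"
  shows "bin_class a (t + a * t\<^sup>2) = 0"
proof -
  have "bin_class a (t + a * t\<^sup>2) = bin_class a 0"
  proof (rule bin_class_eqI[OF assms, of _ 1 t 0 1])
    fix x y
    have "a * (1 * x + t * y)\<^sup>2 + (1 * x + t * y) * (0 * x + 1 * y) + 0 * (0 * x + 1 * y)\<^sup>2
      = a * x\<^sup>2 + x * y + (t + a * t\<^sup>2) * y\<^sup>2 + 2 * (a * x * t * y)"
      by (simp add: power2_eq_square algebra_simps)
    then show "a * (1 * x + t * y)\<^sup>2 + (1 * x + t * y) * (0 * x + 1 * y) + 0 * (0 * x + 1 * y)\<^sup>2
      = a * x\<^sup>2 + x * y + (t + a * t\<^sup>2) * y\<^sup>2" by (simp add: assms)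
  qed
  then show ?thesis by (simp add: bin_class_0[OF assms])
qed

text \<open>The case of two equal arguments and no others. The previous relation gives [b, 1] +
  [b, b] = 0 and [1, b] + [1, b^2] = 0, and [1, b] has order at most two.\<close>

lemma bin_class_alternating:
  fixes b :: "'a::field"
  assumes "(2::'a) = 0"
  shows "bin_class 1 (b * b) + bin_class b b = 0"
proof -
  have "bin_class b 1 + bin_class b b = 0"
    using bin_class_artin_schreier[OF assms, of b 1] by (simp add: bin_class_add_right[OF assms])
  moreover have "bin_class 1 b + bin_class 1 (b * b) = 0"
    using bin_class_artin_schreier[OF assms, of 1 b] by (simp add: bin_class_add_right[OF assms] power2_eq_square)
  moreover have "bin_class 1 b + bin_class 1 b = 0"
    using bin_class_add_right[OF assms, of 1 b b] double_eq_0[OF assms, of b] by (simp add: bin_class_0[OF assms])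
  ultimately show ?thesis
    by (metis add.commute add.left_cancel bin_class_commute[OF assms])
qed

section \<open>Sums of binary forms over complementary subproducts\<close>

text \<open>
  \<open>subprod_class B u v\<close> is the sum of the classes of \<open>[u \<Prod>S, v \<Prod>(B - S)]\<close> over all
  sub-multisets \<open>S\<close> of \<open>B\<close>, counted with multiplicity.
\<close>

definition subprod_step :: "'a::field \<Rightarrow> ('a \<Rightarrow> 'a \<Rightarrow> 'a witt) \<Rightarrow> 'a \<Rightarrow> 'a \<Rightarrow> 'a witt" where
  "subprod_step b f u v = f u (b * v) + f (b * u) v"

definition subprod_class :: "'a::field multiset \<Rightarrow> 'a \<Rightarrow> 'a \<Rightarrow> 'a witt" where
  "subprod_class = fold_mset subprod_step bin_class"

lemma subprod_class_empty: "subprod_class {#} = bin_class"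
  by (simp add: subprod_class_def)

text \<open>The steps of different factors commute, which makes the fold over a multiset well
  defined; the new factor goes to one of the two sides.\<close>

lemma subprod_class_add:
  "subprod_class (add_mset b B) u v = subprod_class B u (b * v) + subprod_class B (b * u) v"
proof -
  interpret comp_fun_commute "subprod_step :: 'a \<Rightarrow> _"
    by unfold_locales (auto simp: fun_eq_iff subprod_step_def mult_ac add_ac)
  show ?thesis by (simp add: subprod_class_def subprod_step_def)
qed

lemma smult_orth_sum:
  "A \<in> carrier_mat n n \<Longrightarrow> B \<in> carrier_mat m m \<Longrightarrow> c \<cdot>\<^sub>m orth_sum A B = orth_sum (c \<cdot>\<^sub>m A) (c \<cdot>\<^sub>m B)"
  by (simp add: orth_sum_eq[of _ n _ m] smult_four_block_mat[of A n n _ m _ m] zero_carrier_mat)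

text \<open>Induction on the slots, starting from the fact that c [1, a] is [c, a / c]. If the slots
  in S go to the left entry, the right entry is a / (c \<Prod>S), which is the fixed quotient a / (c
  \<Prod>bs) times the slots outside S.\<close>

lemma of_form_qpfister_smult:
  fixes a c :: "'a::field"
  assumes two: "(2::'a) = 0" and "0 \<notin> set bs" "c \<noteq> 0"
  shows "of_form (c \<cdot>\<^sub>m qpfister bs a) = subprod_class (mset bs) c (a / (c * prod_list bs))"
  using assms(2,3)
proof (induction bs arbitrary: c)
  case Nil
  have "isometric (c \<cdot>\<^sub>m binary_form 1 a) (binary_form c (a / c))"
    using Nil two
    by (intro isometric_planes[of _ _ 1 0 0 c] ns_smult ns_binary)
       (auto simp: quad_eval_smult_mat[of _ 2] quad_eval_binary field_simps power2_eq_square)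
  then show ?case
    using Nil two by (simp add: qpfister_Nil subprod_class_empty bin_class_def of_form_isometric ns_smult ns_binary)
next
  case (Cons b bs)
  then have nz: "b \<noteq> 0" "0 \<notin> set bs" "prod_list bs \<noteq> 0" "c \<noteq> 0" by (auto simp: prod_list_zero_iff)
  have ns: "d \<cdot>\<^sub>m qpfister bs a \<in> ns_forms" if "d \<noteq> 0" for d
    using nz that by (intro ns_smult qpfister_ns two)
  have "c \<cdot>\<^sub>m qpfister (b # bs) a = orth_sum (c \<cdot>\<^sub>m qpfister bs a) (c \<cdot>\<^sub>m (b \<cdot>\<^sub>m qpfister bs a))"
    unfolding qpfister_Cons
    by (rule smult_orth_sum[OF qpfister_carrier smult_carrier_mat[OF qpfister_carrier]])
  also have "c \<cdot>\<^sub>m (b \<cdot>\<^sub>m qpfister bs a) = (b * c) \<cdot>\<^sub>m qpfister bs a"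
    by (auto simp: mult_ac)
  finally show ?case
    using nz by (simp add: of_form_orth_sum ns Cons.IH subprod_class_add mult_ac)
qed

text \<open>With \<open>prod_list bs\<close> as a factor of the last slot the denominator
  disappears.\<close>

lemma of_form_qpfister:
  fixes a :: "'a::field"
  assumes "(2::'a) = 0" and "0 \<notin> set bs"
  shows "of_form (qpfister bs (a * prod_list bs)) = subprod_class (mset bs) 1 a"
proof -
  have "prod_list bs \<noteq> 0" using assms by (auto simp: prod_list_zero_iff)
  moreover have "1 \<cdot>\<^sub>m qpfister bs (a * prod_list bs) = qpfister bs (a * prod_list bs)" by auto
  ultimately show ?thesis using of_form_qpfister_smult[OF assms, of 1 "a * prod_list bs"] by simp
qed

section \<open>Symmetry, additivity and alternation\<close>

context
  assumes two: "(2::'a::field) = 0"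
begin

lemma subprod_class_commute: "subprod_class B u v = subprod_class B v (u::'a)"
  by (induction B arbitrary: u v)
     (auto simp: subprod_class_empty subprod_class_add bin_class_commute[OF two] add.commute)

lemma subprod_class_add_right:
  "subprod_class B u (v + w) = subprod_class B u v + subprod_class B u (w::'a)"
  by (induction B arbitrary: u v w)
     (auto simp: subprod_class_empty subprod_class_add bin_class_add_right[OF two] add_ac distrib_left)

lemma subprod_class_0: "subprod_class B u (0::'a) = 0"
  using subprod_class_add_right[of B u 0 0] by simp

lemma subprod_class_double: "subprod_class B u v + subprod_class B u (v::'a) = 0"
  by (simp flip: subprod_class_add_right add: double_eq_0[OF two] subprod_class_0)

lemma subprod_class_square: "subprod_class B (u * c\<^sup>2) v = subprod_class B u (v * (c::'a)\<^sup>2)"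
  by (induction B arbitrary: u v)
     (simp_all add: subprod_class_empty subprod_class_add bin_class_square[OF two] flip: mult.assoc)

text \<open>After splitting off one factor, both sides consist of the term with a and b on the right
  and the term with one of them on each side; the latter is symmetric.\<close>

lemma subprod_class_swap:
  "subprod_class (add_mset a B) 1 b = subprod_class (add_mset b B) 1 (a::'a)"
  by (simp add: subprod_class_add mult.commute subprod_class_commute[of B a b])

text \<open>If a further factor \<open>c\<close> is present, splitting off \<open>b\<close> and
  \<open>c\<close> gives four terms that cancel in pairs: one pair agrees after moving the square b
  * b across, the other after exchanging the two sides. Without such a factor the binary relation is
  used.\<close>

lemma subprod_class_alternating: "subprod_class (add_mset b B) 1 (b::'a) = 0"
proof (cases B)
  case empty
  then show ?thesis by (simp add: subprod_class_add subprod_class_empty bin_class_alternating[OF two])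
next
  case (add c C)
  have "subprod_class C c (b * b) = subprod_class C 1 (c * (b * b))"
    using subprod_class_square[of C c b 1] subprod_class_commute[of C "c * b\<^sup>2" 1]
    by (simp add: power2_eq_square)
  moreover have "subprod_class C (c * b) b = subprod_class C b (c * b)" by (rule subprod_class_commute)
  ultimately show ?thesis
    using subprod_class_double[of C 1 "c * (b * b)"] subprod_class_double[of C b "c * b"]
    by (simp add: add subprod_class_add add_ac)
qed

text \<open>
  The class of the Pfister form \<open>\<langle>\<langle>y\<^sub>2, \<dots>, y\<^sub>n, y\<^sub>1\<cdots>y\<^sub>n]]\<close>; by \<open>subprod_class_swap\<close> it does not
  depend on which of the \<open>y\<^sub>i\<close> is called \<open>y\<^sub>1\<close>.  As a function of the \<open>y\<^sub>i\<close> it is additive in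
  each argument and alternating, like the differential form \<open>y\<^sub>1 dy\<^sub>2 \<and> \<dots> \<and> dy\<^sub>n\<close> modulo exact forms.
\<close>

definition alt_class :: "'a multiset \<Rightarrow> 'a witt" where
  "alt_class X = (let a = SOME a. a \<in># X in subprod_class (X - {#a#}) 1 a)"

lemma alt_class_add: "alt_class (add_mset a B) = subprod_class B 1 a"
proof -
  define c where "c = (SOME c. c \<in># add_mset a B)"
  have c: "c \<in># add_mset a B" unfolding c_def by (rule someI[of _ a]) simp
  have "alt_class (add_mset a B) = subprod_class (add_mset a B - {#c#}) 1 c"
    by (simp add: alt_class_def c_def Let_def)
  also have "\<dots> = subprod_class B 1 a"
  proof (cases "c = a")
    case False
    with c obtain C where "B = add_mset c C" by (auto dest: multi_member_split)
    with False show ?thesis by (simp add: subprod_class_swap)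
  qed simp
  finally show ?thesis .
qed

lemma alt_class_plus:
  "alt_class (add_mset (a + b) B) = alt_class (add_mset a B) + alt_class (add_mset b B)"
  by (simp add: alt_class_add subprod_class_add_right)

lemma alt_class_repeat: "alt_class (add_mset a (add_mset a B)) = 0"
  by (simp add: alt_class_add[of a "add_mset a B"] subprod_class_alternating)

lemma alt_class_double: "X \<noteq> {#} \<Longrightarrow> alt_class X + alt_class X = 0"
  by (metis alt_class_add multiset_cases subprod_class_double)

text \<open>Adding \<open>z\<close> to another argument changes the class by a term in which
  \<open>z\<close> occurs twice, and this term vanishes. The multiset \<open>V\<close> collects the
  arguments that are already treated.\<close>

lemma alt_class_shear:
  "alt_class (add_mset z ({#u + z. u \<in># U#} + V)) = alt_class (add_mset z (U + V))"
proof (induction U arbitrary: V)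
  case (add u U)
  have "alt_class (add_mset z ({#u + z. u \<in># add_mset u U#} + V))
    = alt_class (add_mset (u + z) (add_mset z ({#u + z. u \<in># U#} + V)))"
    by (simp add: add_mset_commute)
  also have "\<dots> = alt_class (add_mset u (add_mset z ({#u + z. u \<in># U#} + V)))
      + alt_class (add_mset z (add_mset z ({#u + z. u \<in># U#} + V)))"
    by (rule alt_class_plus)
  also have "\<dots> = alt_class (add_mset z ({#u + z. u \<in># U#} + add_mset u V))"
    by (simp add: alt_class_repeat add_mset_commute[of u z])
  also have "\<dots> = alt_class (add_mset z (U + add_mset u V))"
    by (rule add.IH)
  finally show ?case by simp
qed simp

text \<open>In the multilinear expansion all terms with \<open>z\<close> in two places vanish; the
  sum runs over the single place where \<open>z\<close> is taken.\<close>

lemma alt_class_expand: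
  assumes "finite I"
  shows "alt_class ({#x j + z. j \<in># mset_set I#} + V) = alt_class ({#x j. j \<in># mset_set I#} + V)
    + (\<Sum>i\<in>I. alt_class (add_mset z ({#x j. j \<in># mset_set (I - {i})#} + V)))"
  using assms
proof (induction I arbitrary: V)
  case (insert k I)
  let ?X = "\<lambda>I. {#x j. j \<in># mset_set I#}" and ?Y = "{#x j + z. j \<in># mset_set I#}"
  have "alt_class ({#x j + z. j \<in># mset_set (insert k I)#} + V)
    = alt_class (?Y + add_mset (x k) V) + alt_class (add_mset z (?Y + V))"
    using insert by (simp add: alt_class_plus)
  also have "alt_class (add_mset z (?Y + V)) = alt_class (add_mset z (?X I + V))"
    using alt_class_shear[of z "?X I" V] by (simp add: multiset.map_comp o_def)
  also have "alt_class (?Y + add_mset (x k) V) = alt_class (?X I + add_mset (x k) V)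
    + (\<Sum>i\<in>I. alt_class (add_mset z (?X (I - {i}) + add_mset (x k) V)))"
    by (rule insert.IH)
  also have "(\<Sum>i\<in>I. alt_class (add_mset z (?X (I - {i}) + add_mset (x k) V)))
    = (\<Sum>i\<in>I. alt_class (add_mset z (?X (insert k I - {i}) + V)))"
  proof (rule sum.cong[OF refl])
    fix i assume i: "i \<in> I"
    with insert have "insert k I - {i} = insert k (I - {i})" by auto
    with insert i show "alt_class (add_mset z (?X (I - {i}) + add_mset (x k) V))
      = alt_class (add_mset z (?X (insert k I - {i}) + V))" by simp
  qed
  finally show ?case using insert by (simp add: add_ac)
qed simp

text \<open>
  The analogue for differential forms: the contraction of \<open>dx\<^sub>0 \<and> \<dots> \<and> dx\<^sub>n\<close> with a constant vector
  field is decomposable.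
\<close>

lemma alt_class_sum_omit:
  assumes J: "finite J" "I \<subseteq> J" "k \<in> I"
  shows "(\<Sum>i\<in>I. alt_class {#x j. j \<in># mset_set (J - {i})#})
    = alt_class {#if j \<in> I then x j + x k else x j. j \<in># mset_set (J - {k})#}"
proof -
  let ?X = "\<lambda>I. {#x j. j \<in># mset_set I#}"
  have fin: "finite I" using J finite_subset by blast
  have un: "mset_set (A \<union> B) = mset_set A + mset_set B" if "A \<subseteq> J" "B \<subseteq> J" "A \<inter> B = {}" for A B
    using that J by (simp add: mset_set_Union finite_subset)
  have "J - {k} = (I - {k}) \<union> (J - I)" using J by auto
  then have split: "mset_set (J - {k}) = mset_set (I - {k}) + mset_set (J - I)"
    using J by (simp only:) (subst un, auto)
  then have "{#if j \<in> I then x j + x k else x j. j \<in># mset_set (J - {k})#}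
    = {#if j \<in> I then x j + x k else x j. j \<in># mset_set (I - {k})#}
      + {#if j \<in> I then x j + x k else x j. j \<in># mset_set (J - I)#}"
    by simp
  also have "{#if j \<in> I then x j + x k else x j. j \<in># mset_set (I - {k})#} = {#x j + x k. j \<in># mset_set (I - {k})#}"
    using fin by (intro image_mset_cong) auto
  also have "{#if j \<in> I then x j + x k else x j. j \<in># mset_set (J - I)#} = ?X (J - I)"
    using J by (intro image_mset_cong) auto
  \<comment> \<open>Expansion with z = \<open>x k\<close>: in the term of index i,
    \<open>x k\<close> replaces \<open>x i\<close>, so this term is the class with
    \<open>x i\<close> omitted; the leading term is the one with \<open>x k\<close> omitted.\<close>
  also have "alt_class ({#x j + x k. j \<in># mset_set (I - {k})#} + ?X (J - I))
    = alt_class (?X (I - {k}) + ?X (J - I))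
      + (\<Sum>i\<in>I - {k}. alt_class (add_mset (x k) (?X (I - {k} - {i}) + ?X (J - I))))"
    using fin by (intro alt_class_expand) auto
  also have "?X (I - {k}) + ?X (J - I) = ?X (J - {k})"
    by (simp add: split)
  also have "(\<Sum>i\<in>I - {k}. alt_class (add_mset (x k) (?X (I - {k} - {i}) + ?X (J - I))))
    = (\<Sum>i\<in>I - {k}. alt_class (?X (J - {i})))"
  proof (rule sum.cong[OF refl])
    fix i assume i: "i \<in> I - {k}"
    have "J - {i} = insert k (I - {k} - {i} \<union> (J - I))" using i J by auto
    then have "?X (J - {i}) = add_mset (x k) (?X (I - {k} - {i} \<union> (J - I)))"
      using J fin by simp
    also have "?X (I - {k} - {i} \<union> (J - I)) = ?X (I - {k} - {i}) + ?X (J - I)"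
      using J by (subst un) auto
    finally show "alt_class (add_mset (x k) (?X (I - {k} - {i}) + ?X (J - I))) = alt_class (?X (J - {i}))"
      by simp
  qed
  finally show ?thesis using sum.remove[OF fin J(3), of "\<lambda>i. alt_class (?X (J - {i}))"] by simp
qed

text \<open>Any enumeration of \<open>Y\<close> works: its first entry enters only the last slot,
  the others are the bilinear slots and have to be nonzero.\<close>

lemma alt_class_pfister:
  assumes "size Y = n" "n \<ge> 1" "0 \<notin># Y"
  shows "alt_class Y \<in> of_form ` quadratic_pfister_forms n"
proof -
  obtain xs where xs: "mset xs = Y" using ex_mset by blast
  with assms obtain a bs where ab: "xs = a # bs" by (cases xs) auto
  have "0 \<notin> set bs" "length bs = n - 1" using assms xs ab by auto
  moreover have "alt_class Y = of_form (qpfister bs (a * prod_list bs))"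
    using ab xs of_form_qpfister[OF two \<open>0 \<notin> set bs\<close>] by (auto simp: alt_class_add)
  ultimately show ?thesis unfolding quadratic_pfister_forms_eq by blast
qed

text \<open>Last slot 0 makes every binary summand [u, 0] vanish. This accounts for the empty sum in
  the generated subgroup.\<close>

lemma zero_in_pfister: "0 \<in> of_form ` (quadratic_pfister_forms n :: 'a mat set)"
proof -
  have "of_form (qpfister (replicate (n - 1) 1) (0 * prod_list (replicate (n - 1) 1))) = (0 :: 'a witt)"
    by (subst of_form_qpfister) (auto simp: two subprod_class_0)
  then show ?thesis unfolding quadratic_pfister_forms_eq by (force intro!: image_eqI[rotated])
qed

end

section \<open>A rank one valuation on the rational function field\<close>

definition nth_prime :: "nat \<Rightarrow> nat" where
  "nth_prime = enumerate {p. prime p}"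

lemma prime_nth_prime [simp]: "prime (nth_prime i)"
  using enumerate_in_set[OF primes_infinite, of i] by (simp add: nth_prime_def)

lemma nth_prime_eq_iff [simp]: "nth_prime i = nth_prime j \<longleftrightarrow> i = j"
  using inj_enumerate[OF primes_infinite] by (auto simp: nth_prime_def inj_def)

text \<open>Evenness of the p-adic valuation. The sum of the two multiplicities has the parity of
  their difference, and this parity is the same for all fractions that represent r.\<close>

definition even_at :: "nat \<Rightarrow> rat \<Rightarrow> bool" where
  "even_at p r \<longleftrightarrow> (\<exists>N M. N > 0 \<and> M > 0 \<and> r = of_nat N / of_nat M \<and>
    even (multiplicity p N + multiplicity p M))"

lemma even_at_frac:
  assumes p: "prime p" and NM: "N > 0" "M > 0"
  shows "even_at p (of_nat N / of_nat M) \<longleftrightarrow> even (multiplicity p N + multiplicity p M)"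
proof
  assume "even_at p (of_nat N / of_nat M)"
  then obtain A B where AB: "A > 0" "B > 0" "(of_nat N / of_nat M :: rat) = of_nat A / of_nat B"
    "even (multiplicity p A + multiplicity p B)" by (auto simp: even_at_def)
  have "of_nat (N * B) = (of_nat (A * M) :: rat)"
    using AB(1-3) NM by (simp add: field_simps)
  then have eq: "N * B = A * M" by (simp only: of_nat_eq_iff)
  have "multiplicity p N + multiplicity p B = multiplicity p A + multiplicity p M"
    using arg_cong[OF eq, of "multiplicity p"] p NM AB(1,2)
    by (simp add: prime_elem_multiplicity_mult_distrib)
  with AB(4) show "even (multiplicity p N + multiplicity p M)" by presburger
qed (use NM in \<open>auto simp: even_at_def\<close>)

lemma pos_rat_obtain:
  assumes "(r :: rat) > 0"
  obtains N M where "N > 0" "M > 0" "r = of_nat N / of_nat M"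
proof -
  obtain a b where ab: "r = Rat.Fract a b" "b > 0" by (cases r) auto
  with assms have "a > 0" by (simp add: Rat.zero_less_Fract_iff)
  with ab that[of "nat a" "nat b"] show ?thesis by (simp add: Fract_of_int_quotient)
qed

lemma even_at_mult:
  assumes p: "prime p" and rs: "r > 0" "s > 0"
  shows "even_at p (r * s) \<longleftrightarrow> (even_at p r \<longleftrightarrow> even_at p s)"
proof -
  obtain N M where r: "N > 0" "M > 0" "r = of_nat N / of_nat M" using rs by (blast elim: pos_rat_obtain)
  obtain A B where s: "A > 0" "B > 0" "s = of_nat A / of_nat B" using rs by (blast elim: pos_rat_obtain)
  have "r * s = of_nat (N * A) / of_nat (M * B)" by (simp add: r s)
  then show ?thesis
    using p r(1,2) s(1,2)
    by (simp add: even_at_frac r(3) s(3) prime_elem_multiplicity_mult_distrib del: of_nat_mult) presburger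
qed

lemma poly_eval_superset:
  assumes "finite M" "Poly_Mapping.keys p \<subseteq> M"
  shows "poly_eval f \<alpha> p = (\<Sum>m\<in>M. if m \<in> Poly_Mapping.keys p then
    f (Poly_Mapping.lookup p m) * (\<Prod>i\<in>Poly_Mapping.keys m. \<alpha> i ^ Poly_Mapping.lookup m i) else 0)"
  unfolding poly_eval_def using assms by (intro sum.mono_neutral_cong_left) auto

section \<open>Monomials of the function field as natural numbers\<close>

locale rational_functions =
  fixes \<iota> :: "'k::field \<Rightarrow> 'e::field" and n :: nat and \<alpha> :: "nat \<Rightarrow> 'e"
  assumes rational: "rational_function_field \<iota> n \<alpha>"
begin

sublocale \<iota>: field_hom \<iota>
  using rational by (simp add: rational_function_field_def)

text \<open>
  The monomial \<open>\<Prod>\<alpha>\<^sub>i^e\<^sub>i\<close> is encoded by the natural number \<open>\<Prod>p\<^sub>i^e\<^sub>i\<close>.  This turns divisibility of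
  monomials into divisibility of numbers, and the order of the numbers is a monomial order.
\<close>

definition monom_of :: "nat \<Rightarrow> 'e" where
  "monom_of N = (\<Prod>i\<le>n. \<alpha> i ^ multiplicity (nth_prime i) N)"

definition codes :: "nat set" where
  "codes = {N. N > 0 \<and> prime_factors N \<subseteq> nth_prime ` {..n}}"

lemma codes_pos: "N \<in> codes \<Longrightarrow> N > 0"
  by (simp add: codes_def)

lemma codes_mult: "N \<in> codes \<Longrightarrow> M \<in> codes \<Longrightarrow> N * M \<in> codes"
  by (auto simp: codes_def prime_factors_product)

lemma one_in_codes [simp]: "1 \<in> codes" "Suc 0 \<in> codes"
  by (simp_all add: codes_def)

lemma nth_prime_in_codes: "i \<le> n \<Longrightarrow> nth_prime i \<in> codes"
  using prime_gt_0_nat[OF prime_nth_prime, of i] by (auto simp: codes_def prime_factorization_prime)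

lemma monom_of_mult: "N > 0 \<Longrightarrow> M > 0 \<Longrightarrow> monom_of (N * M) = monom_of N * monom_of M"
  by (simp add: monom_of_def prime_elem_multiplicity_mult_distrib power_add prod.distrib)

lemma monom_of_1 [simp]: "monom_of 1 = 1" "monom_of (Suc 0) = 1"
  by (simp_all add: monom_of_def)

lemma multiplicity_nth_prime: "multiplicity (nth_prime i) (nth_prime j) = (if i = j then 1 else 0)"
  by (auto simp: prime_multiplicity_other)

lemma monom_of_nth_prime:
  assumes "i \<le> n"
  shows "monom_of (nth_prime i) = \<alpha> i"
proof -
  have "monom_of (nth_prime i) = (\<Prod>j\<le>n. if j = i then \<alpha> j else 1)"
    unfolding monom_of_def by (intro prod.cong) (auto simp: multiplicity_nth_prime)
  then show ?thesis using assms by (simp add: prod.delta)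
qed

definition exps :: "nat \<Rightarrow> nat \<Rightarrow>\<^sub>0 nat" where
  "exps N = (\<Sum>i\<le>n. Poly_Mapping.single i (multiplicity (nth_prime i) N))"

lemma lookup_exps: "Poly_Mapping.lookup (exps N) i = (if i \<le> n then multiplicity (nth_prime i) N else 0)"
  by (simp add: exps_def lookup_sum lookup_single when_def)

lemma inj_on_exps: "inj_on exps codes"
proof (rule inj_onI)
  fix N M assume N: "N \<in> codes" and M: "M \<in> codes" and eq: "exps N = exps M"
  show "N = M"
  proof (rule multiplicity_eq_nat)
    fix p :: nat assume p: "prime p"
    show "multiplicity p N = multiplicity p M"
    proof (cases "p \<in> nth_prime ` {..n}")
      case True
      then show ?thesis using arg_cong[OF eq, of Poly_Mapping.lookup]
        by (auto simp: fun_eq_iff lookup_exps split: if_splits)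
    next
      case False
      then have "p \<notin> prime_factors N" "p \<notin> prime_factors M" using N M by (auto simp: codes_def)
      with p codes_pos[OF N] codes_pos[OF M] show ?thesis
        by (auto simp: in_prime_factors_iff not_dvd_imp_multiplicity_0)
    qed
  qed (use codes_pos[OF N] codes_pos[OF M] in auto)
qed

lemma monom_of_exps: "monom_of N = (\<Prod>i\<in>Poly_Mapping.keys (exps N). \<alpha> i ^ Poly_Mapping.lookup (exps N) i)"
  unfolding monom_of_def
  by (rule prod.mono_neutral_cong_right) (auto simp: lookup_exps in_keys_iff split: if_splits)

text \<open>Algebraic independence, applied to the polynomial with coefficient \<open>c N\<close> at
  the exponent vector of N. By unique factorization, different codes have different exponent
  vectors.\<close>

lemma monomials_independent:
  assumes K: "finite K" "K \<subseteq> codes" and z: "(\<Sum>N\<in>K. \<iota> (c N) * monom_of N) = 0" and N: "N \<in> K"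
  shows "c N = 0"
proof -
  define p where "p = (\<Sum>N\<in>K. Poly_Mapping.single (exps N) (c N))"
  have inj: "inj_on exps K" using inj_on_exps K(2) by (rule inj_on_subset)
  have lookup_p: "Poly_Mapping.lookup p (exps N) = c N" if "N \<in> K" for N
  proof -
    have "Poly_Mapping.lookup p (exps N) = (\<Sum>M\<in>K. if M = N then c M else 0)"
      unfolding p_def lookup_sum lookup_single when_def
      using that inj by (intro sum.cong) (auto dest: inj_onD)
    then show ?thesis using that K by simp
  qed
  have keys: "Poly_Mapping.keys p \<subseteq> exps ` K"
    unfolding p_def by (rule order_trans[OF keys_sum]) (auto split: if_splits)
  have "poly_eval \<iota> \<alpha> p = (\<Sum>m\<in>exps ` K. \<iota> (Poly_Mapping.lookup p m) *
      (\<Prod>i\<in>Poly_Mapping.keys m. \<alpha> i ^ Poly_Mapping.lookup m i))"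
    unfolding poly_eval_superset[OF finite_imageI[OF K(1)] keys]
    by (intro sum.cong) (auto simp: in_keys_iff)
  also have "\<dots> = (\<Sum>N\<in>K. \<iota> (c N) * monom_of N)"
    unfolding sum.reindex[OF inj] by (intro sum.cong) (auto simp: lookup_p monom_of_exps)
  finally have "poly_eval \<iota> \<alpha> p = 0" using z by simp
  moreover have "p \<in> polys_upto n"
    using keys by (fastforce simp: polys_upto_def in_keys_iff lookup_exps split: if_splits)
  ultimately have "p = 0"
    using rational by (auto simp: rational_function_field_def algebraically_independent_def)
  then show ?thesis using lookup_p[OF N] by simp
qed

subsection \<open>The filtration of the polynomial ring\<close>

text \<open>The filtration is multiplicative, with \<open>filt r\<close> times \<open>filt s\<close>
  inside \<open>filt (r * s)\<close>, so codes act as degrees that multiply instead of adding. Codes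
  are positive, hence level 0 is trivial.\<close>

definition filt :: "nat \<Rightarrow> 'e set" where
  "filt r = {\<Sum>N\<in>codes \<inter> {..r}. \<iota> (c N) * monom_of N | c. True}"

lemma filt_add: "x \<in> filt r \<Longrightarrow> y \<in> filt r \<Longrightarrow> x + y \<in> filt r"
proof -
  assume "x \<in> filt r" "y \<in> filt r"
  then obtain c d where "x = (\<Sum>N\<in>codes \<inter> {..r}. \<iota> (c N) * monom_of N)"
    "y = (\<Sum>N\<in>codes \<inter> {..r}. \<iota> (d N) * monom_of N)" by (auto simp: filt_def)
  then have "x + y = (\<Sum>N\<in>codes \<inter> {..r}. \<iota> (c N + d N) * monom_of N)"
    by (simp add: sum.distrib distrib_right \<iota>.hom_add)
  then show ?thesis unfolding filt_def by (intro CollectI exI[of _ "\<lambda>N. c N + d N"]) simp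
qed

lemma filt_scale: "x \<in> filt r \<Longrightarrow> \<iota> a * x \<in> filt r"
proof -
  assume "x \<in> filt r"
  then obtain c where "x = (\<Sum>N\<in>codes \<inter> {..r}. \<iota> (c N) * monom_of N)" by (auto simp: filt_def)
  then have "\<iota> a * x = (\<Sum>N\<in>codes \<inter> {..r}. \<iota> (a * c N) * monom_of N)"
    by (simp add: sum_distrib_left mult.assoc \<iota>.hom_mult)
  then show ?thesis unfolding filt_def by (intro CollectI exI[of _ "\<lambda>N. a * c N"]) simp
qed

lemma filt_zero [simp]: "0 \<in> filt r"
  unfolding filt_def by (intro CollectI exI[of _ "\<lambda>_. 0"]) simp

lemma filt_0: "filt 0 = {0}"
proof -
  have "codes \<inter> {..0} = {}" using codes_pos by auto
  then show ?thesis by (simp add: filt_def)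
qed

lemma filt_uminus: "x \<in> filt r \<Longrightarrow> - x \<in> filt r"
  using filt_scale[of x r "- 1"] by (simp add: \<iota>.hom_uminus)

lemma filt_diff: "x \<in> filt r \<Longrightarrow> y \<in> filt r \<Longrightarrow> x - y \<in> filt r"
  using filt_add[of x r "- y"] filt_uminus by simp

lemma filt_mono:
  assumes "r \<le> s"
  shows "filt r \<subseteq> filt s"
proof
  fix x assume "x \<in> filt r"
  then obtain c where x: "x = (\<Sum>N\<in>codes \<inter> {..r}. \<iota> (c N) * monom_of N)" by (auto simp: filt_def)
  have "x = (\<Sum>N\<in>codes \<inter> {..s}. \<iota> (if N \<le> r then c N else 0) * monom_of N)"
    unfolding x using assms by (intro sum.mono_neutral_cong_left) auto
  then show "x \<in> filt s"
    unfolding filt_def by (intro CollectI exI[of _ "\<lambda>N. if N \<le> r then c N else 0"]) simp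
qed

lemma filt_monom: "N \<in> codes \<Longrightarrow> N \<le> r \<Longrightarrow> \<iota> c * monom_of N \<in> filt r"
proof -
  assume N: "N \<in> codes" "N \<le> r"
  have "\<iota> c * monom_of N = (\<Sum>M\<in>codes \<inter> {..r}. \<iota> (if M = N then c else 0) * monom_of M)"
    using N by (subst sum.remove[of _ N]) auto
  then show ?thesis
    unfolding filt_def by (intro CollectI exI[of _ "\<lambda>M. if M = N then c else 0"]) simp
qed

lemma filt_sum: "(\<And>a. a \<in> A \<Longrightarrow> f a \<in> filt r) \<Longrightarrow> sum f A \<in> filt r"
  by (induction A rule: infinite_finite_induct) (auto intro: filt_add)

lemma filt_mult:
  assumes "x \<in> filt r" "y \<in> filt s"
  shows "x * y \<in> filt (r * s)"
proof -
  obtain c where x: "x = (\<Sum>N\<in>codes \<inter> {..r}. \<iota> (c N) * monom_of N)"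
    using assms by (auto simp: filt_def)
  obtain d where y: "y = (\<Sum>N\<in>codes \<inter> {..s}. \<iota> (d N) * monom_of N)"
    using assms by (auto simp: filt_def)
  have "\<iota> (c N) * monom_of N * (\<iota> (d M) * monom_of M) \<in> filt (r * s)"
    if N: "N \<in> codes \<inter> {..r}" and M: "M \<in> codes \<inter> {..s}" for N M
  proof -
    have "\<iota> (c N) * monom_of N * (\<iota> (d M) * monom_of M) = \<iota> (c N * d M) * monom_of (N * M)"
      using N M codes_pos by (simp add: monom_of_mult \<iota>.hom_mult mult_ac)
    moreover have "N * M \<in> codes" "N * M \<le> r * s" using N M by (auto intro: codes_mult mult_mono)
    ultimately show ?thesis by (simp add: filt_monom)
  qed
  then show ?thesis unfolding x y sum_product by (intro filt_sum)
qed

lemma filt_lead: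
  assumes "x \<in> filt r"
  shows "x \<in> filt (r - 1) \<or> (r \<in> codes \<and> (\<exists>c. x - \<iota> c * monom_of r \<in> filt (r - 1)))"
proof (cases "r \<in> codes")
  case True
  then have r: "r > 0" by (rule codes_pos)
  obtain c where x: "x = (\<Sum>N\<in>codes \<inter> {..r}. \<iota> (c N) * monom_of N)"
    using assms by (auto simp: filt_def)
  have "codes \<inter> {..r} = insert r (codes \<inter> {..r - 1})" "r \<notin> codes \<inter> {..r - 1}" using True r by auto
  then have "x - \<iota> (c r) * monom_of r = (\<Sum>N\<in>codes \<inter> {..r - 1}. \<iota> (c N) * monom_of N)"
    unfolding x by simp
  then have "x - \<iota> (c r) * monom_of r \<in> filt (r - 1)" unfolding filt_def by blast
  with True show ?thesis by blast
next
  case False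
  then have "codes \<inter> {..r} = codes \<inter> {..r - 1}" by (auto simp: le_less)
  then have "filt r = filt (r - 1)" by (simp add: filt_def)
  with assms show ?thesis by simp
qed

text \<open>A nonzero coefficient would make the monomial a linear combination of monomials with
  smaller codes.\<close>

lemma filt_lead_unique:
  assumes N: "N \<in> codes" and x: "\<iota> c * monom_of N \<in> filt (N - 1)"
  shows "c = 0"
proof -
  let ?K = "codes \<inter> {..N - 1}"
  obtain d where d: "\<iota> c * monom_of N = (\<Sum>M\<in>?K. \<iota> (d M) * monom_of M)"
    using x by (auto simp: filt_def)
  have N': "N \<notin> ?K" using codes_pos[OF N] by auto
  have "(\<Sum>M\<in>insert N ?K. \<iota> ((d(N := - c)) M) * monom_of M)
    = \<iota> (- c) * monom_of N + (\<Sum>M\<in>?K. \<iota> (d M) * monom_of M)"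
    using N' by (subst sum.insert) (auto intro!: sum.cong)
  also have "\<dots> = 0" using d by (simp add: \<iota>.hom_uminus)
  finally have "(d(N := - c)) N = 0"
    using N by (intro monomials_independent[of "insert N ?K" "d(N := - c)" N]) auto
  then show ?thesis by simp
qed

definition leading :: "'e \<Rightarrow> 'k \<Rightarrow> nat \<Rightarrow> bool" where
  "leading x c N \<longleftrightarrow> N \<in> codes \<and> c \<noteq> 0 \<and> x - \<iota> c * monom_of N \<in> filt (N - 1)"

lemma leading_filt:
  assumes "leading x c N"
  shows "x \<in> filt N"
proof -
  have "x - \<iota> c * monom_of N \<in> filt N" "\<iota> c * monom_of N \<in> filt N"
    using assms filt_mono[of "N - 1" N] by (auto simp: leading_def intro: filt_monom)
  then show ?thesis using filt_add by fastforce
qed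

lemma leading_exists: "x \<in> filt r \<Longrightarrow> x \<noteq> 0 \<Longrightarrow> \<exists>c N. leading x c N \<and> N \<le> r"
proof (induction r)
  case 0
  then show ?case by (simp add: filt_0)
next
  case (Suc r)
  show ?case
  proof (cases "x \<in> filt r")
    case True
    with Suc show ?thesis by (meson le_SucI)
  next
    case False
    then obtain c where c: "Suc r \<in> codes" "x - \<iota> c * monom_of (Suc r) \<in> filt r"
      using filt_lead[OF Suc.prems(1)] by auto
    with False have "c \<noteq> 0" by auto
    with c have "leading x c (Suc r)" by (simp add: leading_def)
    then show ?thesis by blast
  qed
qed

lemma leading_not_filt:
  assumes "leading x c N" "x \<in> filt M"
  shows "N \<le> M"
proof (rule ccontr)
  assume "\<not> N \<le> M"
  then have "M \<le> N - 1" by simp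
  then have "x \<in> filt (N - 1)" using assms(2) filt_mono by blast
  then have "\<iota> c * monom_of N \<in> filt (N - 1)"
    using assms(1) filt_diff[of x "N - 1" "x - \<iota> c * monom_of N"] by (auto simp: leading_def)
  then show False using assms(1) filt_lead_unique[of N c] by (auto simp: leading_def)
qed

lemma leading_nz: "leading x c N \<Longrightarrow> x \<noteq> 0"
  using leading_not_filt[of x c N 0] codes_pos[of N] by (auto simp: leading_def)

lemma leading_unique:
  assumes "leading x c N" "leading x d M"
  shows "c = d" "N = M"
proof -
  show NM: "N = M"
    using leading_not_filt[OF assms(1) leading_filt[OF assms(2)]]
      leading_not_filt[OF assms(2) leading_filt[OF assms(1)]] by simp
  have "\<iota> (c - d) * monom_of N \<in> filt (N - 1)"
    using assms NM filt_diff[of "x - \<iota> d * monom_of N" "N - 1" "x - \<iota> c * monom_of N"]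
    by (simp add: leading_def \<iota>.hom_minus left_diff_distrib)
  then show "c = d"
    using assms(1) filt_lead_unique[of N "c - d"] by (auto simp: leading_def)
qed

text \<open>Multiplication by a positive number is strictly monotone, so the natural order of the
  codes is a monomial order and every product involving a remainder falls below N * M.\<close>

lemma leading_mult:
  assumes "leading x c N" "leading y d M"
  shows "leading (x * y) (c * d) (N * M)"
proof -
  define x' where "x' = x - \<iota> c * monom_of N"
  define y' where "y' = y - \<iota> d * monom_of M"
  have NM: "N \<in> codes" "M \<in> codes" "c \<noteq> 0" "d \<noteq> 0" using assms by (auto simp: leading_def)
  have pos: "N > 0" "M > 0" using NM codes_pos by auto
  have "x' \<in> filt (N - 1)" "y' \<in> filt (M - 1)" using assms by (auto simp: leading_def x'_def y'_def)
  then have "\<iota> c * monom_of N * y' \<in> filt (N * (M - 1))" "x' * y \<in> filt ((N - 1) * M)"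
    using NM leading_filt[OF assms(2)] by (auto intro!: filt_mult filt_monom)
  moreover have "N * (M - 1) \<le> N * M - 1" "(N - 1) * M \<le> N * M - 1"
    using pos by (auto simp: diff_mult_distrib diff_mult_distrib2)
  ultimately have "x' * y + \<iota> c * monom_of N * y' \<in> filt (N * M - 1)"
    using filt_mono by (intro filt_add) blast+
  also have "x' * y + \<iota> c * monom_of N * y' = x * y - \<iota> (c * d) * monom_of (N * M)"
    using pos by (simp add: x'_def y'_def monom_of_mult \<iota>.hom_mult algebra_simps)
  finally show ?thesis using NM codes_mult by (simp add: leading_def)
qed

lemma leading_add:
  assumes "leading x c N" "y \<in> filt (N - 1)"
  shows "leading (x + y) c N"
proof -
  have "x + y - \<iota> c * monom_of N = (x - \<iota> c * monom_of N) + y" by simp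
  then have "x + y - \<iota> c * monom_of N \<in> filt (N - 1)"
    using assms filt_add by (simp only: leading_def)
  then show ?thesis using assms by (simp add: leading_def)
qed

lemma leading_monom: "N \<in> codes \<Longrightarrow> c \<noteq> 0 \<Longrightarrow> leading (\<iota> c * monom_of N) c N"
  by (simp add: leading_def)

lemma leading_1: "leading 1 1 1"
  using leading_monom[of 1 1] by simp

section \<open>The polynomial ring and its fractions\<close>

definition pols :: "'e set" where
  "pols = (\<Union>r. filt r)"

lemma filt_pols: "x \<in> filt r \<Longrightarrow> x \<in> pols"
  by (auto simp: pols_def)

lemma pols_add: "x \<in> pols \<Longrightarrow> y \<in> pols \<Longrightarrow> x + y \<in> pols"
proof -
  assume "x \<in> pols" "y \<in> pols"
  then obtain r s where "x \<in> filt r" "y \<in> filt s" by (auto simp: pols_def)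
  then have "x \<in> filt (max r s)" "y \<in> filt (max r s)"
    using filt_mono[of r "max r s"] filt_mono[of s "max r s"] by auto
  then show ?thesis using filt_add filt_pols by blast
qed

lemma pols_mult: "x \<in> pols \<Longrightarrow> y \<in> pols \<Longrightarrow> x * y \<in> pols"
  unfolding pols_def using filt_mult by blast

lemma pols_1: "1 \<in> pols"
  using leading_filt[OF leading_1] by (rule filt_pols)

lemma pols_0: "0 \<in> pols"
  using filt_zero by (rule filt_pols)

lemma pols_power: "x \<in> pols \<Longrightarrow> x ^ k \<in> pols"
  by (induction k) (auto intro: pols_mult pols_1)

lemma pols_prod: "(\<And>a. a \<in> A \<Longrightarrow> f a \<in> pols) \<Longrightarrow> prod f A \<in> pols"
  by (induction A rule: infinite_finite_induct) (auto intro: pols_mult pols_1)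

lemma pols_sum: "(\<And>a. a \<in> A \<Longrightarrow> f a \<in> pols) \<Longrightarrow> sum f A \<in> pols"
  by (induction A rule: infinite_finite_induct) (auto intro: pols_add pols_0)

lemma pols_const: "\<iota> c \<in> pols"
  using filt_monom[of 1 1 c] filt_pols by fastforce

lemma leading_var: "i \<le> n \<Longrightarrow> leading (\<alpha> i) 1 (nth_prime i)"
  using leading_monom[of "nth_prime i" 1] by (simp add: nth_prime_in_codes monom_of_nth_prime)

lemma pols_var: "i \<le> n \<Longrightarrow> \<alpha> i \<in> pols"
  using leading_filt[OF leading_var] by (rule filt_pols)

lemma pols_poly_eval:
  assumes "p \<in> polys_upto n"
  shows "poly_eval \<iota> \<alpha> p \<in> pols"
  unfolding poly_eval_def using assms
  by (intro pols_sum pols_mult pols_const pols_prod pols_power pols_var) (auto simp: polys_upto_def)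

lemma quotient_obtain:
  obtains p q where "p \<in> pols" "q \<in> pols" "q \<noteq> 0" "x = p / q"
  using rational pols_poly_eval unfolding rational_function_field_def by metis

lemma pols_leading:
  assumes "p \<in> pols" "p \<noteq> 0"
  obtains c N where "leading p c N"
  using assms leading_exists unfolding pols_def by blast

subsection \<open>Absolute value and leading coefficient\<close>

text \<open>As degrees multiply, the degree of a fraction is a positive rational number; it serves
  directly as the absolute value.\<close>

definition lead_frac :: "'e \<Rightarrow> 'k \<Rightarrow> rat \<Rightarrow> bool" where
  "lead_frac x c r \<longleftrightarrow> (\<exists>p q a b N M. leading p a N \<and> leading q b M \<and> x = p / q \<and> c = a / b \<and>
    r = of_nat N / of_nat M)"

lemma lead_fracI:
  "leading p a N \<Longrightarrow> leading q b M \<Longrightarrow> lead_frac (p / q) (a / b) (of_nat N / of_nat M)"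
  unfolding lead_frac_def by blast

lemma lead_frac_exists:
  assumes "x \<noteq> 0"
  obtains c r where "lead_frac x c r"
proof -
  obtain p q where pq: "p \<in> pols" "q \<in> pols" "q \<noteq> 0" "x = p / q" by (rule quotient_obtain)
  with assms have "p \<noteq> 0" by auto
  with pq show ?thesis by (metis lead_fracI pols_leading that)
qed

lemma lead_frac_unique:
  assumes "lead_frac x c r" "lead_frac x d s"
  shows "c = d" "r = s"
proof -
  obtain p q a b N M where 1: "leading p a N" "leading q b M" "x = p / q" "c = a / b"
    "r = of_nat N / of_nat M" using assms(1) by (auto simp: lead_frac_def)
  obtain p' q' a' b' N' M' where 2: "leading p' a' N'" "leading q' b' M'" "x = p' / q'" "d = a' / b'"
    "s = of_nat N' / of_nat M'" using assms(2) by (auto simp: lead_frac_def)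
  have "p * q' = p' * q"
    using 1(3) 2(3) leading_nz[OF 1(2)] leading_nz[OF 2(2)] by (simp add: field_simps)
  then have "leading (p * q') (a * b') (N * M')" "leading (p * q') (a' * b) (N' * M)"
    using leading_mult[OF 1(1) 2(2)] leading_mult[OF 2(1) 1(2)] by simp_all
  from leading_unique[OF this] have "a * b' = a' * b" and eq: "N * M' = N' * M" by auto
  moreover have "b \<noteq> 0" "b' \<noteq> 0" "M > 0" "M' > 0"
    using 1(2) 2(2) codes_pos by (auto simp: leading_def)
  moreover have "of_nat N * of_nat M' = (of_nat N' * of_nat M :: rat)"
    using eq by (simp flip: of_nat_mult)
  ultimately show "c = d" "r = s" by (simp_all add: 1(4,5) 2(4,5) field_simps)
qed

definition lcoeff :: "'e \<Rightarrow> 'k" where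
  "lcoeff x = (SOME c. \<exists>r. lead_frac x c r)"

definition absv :: "'e \<Rightarrow> rat" where
  "absv x = (if x = 0 then 0 else SOME r. \<exists>c. lead_frac x c r)"

lemma lead_frac_nz: "lead_frac x c r \<Longrightarrow> x \<noteq> 0 \<and> c \<noteq> 0 \<and> r > 0"
  unfolding lead_frac_def using leading_nz
  by (elim exE conjE) (simp add: leading_def codes_pos)

lemma lead_frac_eq:
  assumes "lead_frac x c r"
  shows "lcoeff x = c" "absv x = r"
proof -
  have "\<exists>r. lead_frac x (lcoeff x) r" unfolding lcoeff_def by (rule someI[of _ c]) (use assms in blast)
  then show "lcoeff x = c" using lead_frac_unique[OF assms] by auto
  have "\<exists>c. lead_frac x c (absv x)"
    using lead_frac_nz[OF assms] someI_ex[of "\<lambda>r. \<exists>c. lead_frac x c r"] assms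
    unfolding absv_def by auto
  then show "absv x = r" using lead_frac_unique[OF assms] by auto
qed

lemma lead_frac: "x \<noteq> 0 \<Longrightarrow> lead_frac x (lcoeff x) (absv x)"
  using lead_frac_exists[of x] lead_frac_eq by metis

lemma lead_frac_mult:
  assumes "lead_frac x c r" "lead_frac y d s"
  shows "lead_frac (x * y) (c * d) (r * s)"
proof -
  obtain p q a b N M where 1: "leading p a N" "leading q b M" "x = p / q" "c = a / b"
    "r = of_nat N / of_nat M" using assms(1) by (auto simp: lead_frac_def)
  obtain p' q' a' b' N' M' where 2: "leading p' a' N'" "leading q' b' M'" "y = p' / q'" "d = a' / b'"
    "s = of_nat N' / of_nat M'" using assms(2) by (auto simp: lead_frac_def)
  show ?thesis
    using lead_fracI[OF leading_mult[OF 1(1) 2(1)] leading_mult[OF 1(2) 2(2)]] 1(3-5) 2(3-5) by simp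
qed

lemma absv_0 [simp]: "absv 0 = 0"
  by (simp add: absv_def)

lemma absv_pos [simp]: "absv x > 0 \<longleftrightarrow> x \<noteq> 0"
  using lead_frac[of x] lead_frac_nz by fastforce

lemma absv_nonneg [simp]: "absv x \<ge> 0"
  using absv_pos[of x] by (cases "x = 0") (auto intro: less_imp_le)

lemma absv_mult: "absv (x * y) = absv x * absv y"
  by (cases "x = 0 \<or> y = 0") (auto simp: lead_frac_eq(2)[OF lead_frac_mult[OF lead_frac lead_frac]])

lemma lcoeff_mult: "x \<noteq> 0 \<Longrightarrow> y \<noteq> 0 \<Longrightarrow> lcoeff (x * y) = lcoeff x * lcoeff y"
  by (simp add: lead_frac_eq(1)[OF lead_frac_mult[OF lead_frac lead_frac]])

lemma absv_power: "absv (x ^ k) = absv x ^ k"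
proof (induction k)
  case 0
  show ?case using lead_frac_eq(2)[OF lead_fracI[OF leading_1 leading_1]] by simp
qed (simp add: absv_mult)

lemma leading_eq:
  assumes "leading p c N"
  shows "lcoeff p = c" "absv p = of_nat N"
  using lead_frac_eq[OF lead_fracI[OF assms leading_1]] by simp_all

lemma absv_filt_le:
  assumes "p \<in> filt r"
  shows "absv p \<le> of_nat r"
proof (cases "p = 0")
  case False
  then obtain c N where "leading p c N" "N \<le> r" using leading_exists[OF assms] by blast
  then show ?thesis by (simp add: leading_eq)
qed simp

lemma pols_absv:
  assumes "p \<in> pols"
  obtains N where "absv p = of_nat N" "p \<in> filt N"
proof (cases "p = 0")
  case False
  then obtain c N where "leading p c N" using assms pols_leading by blast
  then show ?thesis using that leading_eq leading_filt by blast
qed (use that[of 0] in simp)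

lemma common_denominator:
  obtains p s q where "p \<in> pols" "s \<in> pols" "q \<in> pols" "q \<noteq> 0" "x = p / q" "y = s / q"
proof -
  obtain p q where 1: "p \<in> pols" "q \<in> pols" "q \<noteq> 0" "x = p / q" by (rule quotient_obtain)
  obtain s t where 2: "s \<in> pols" "t \<in> pols" "t \<noteq> 0" "y = s / t" by (rule quotient_obtain)
  show ?thesis
    by (rule that[of "p * t" "s * q" "q * t"]) (use 1 2 in \<open>auto intro: pols_mult\<close>)
qed

lemma absv_eq_0 [simp]: "absv x = 0 \<longleftrightarrow> x = 0"
  using absv_pos[of x] absv_0 by (metis less_irrefl)

lemma absv_divide: "y \<noteq> 0 \<Longrightarrow> absv (x / y) = absv x / absv y"
  using absv_mult[of "x / y" y] by (simp add: field_simps)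

lemma absv_add: "absv (x + y) \<le> max (absv x) (absv y)"
proof -
  obtain p s q where pq: "p \<in> pols" "s \<in> pols" "q \<in> pols" "q \<noteq> 0" "x = p / q" "y = s / q"
    by (rule common_denominator)
  obtain N where N: "absv p = of_nat N" "p \<in> filt N" using pq by (blast elim: pols_absv)
  obtain M where M: "absv s = of_nat M" "s \<in> filt M" using pq by (blast elim: pols_absv)
  have "p + s \<in> filt (max N M)"
    using N M filt_mono[of N "max N M"] filt_mono[of M "max N M"] by (intro filt_add) auto
  then have "absv (p + s) \<le> max (absv p) (absv s)"
    using absv_filt_le N M by (fastforce simp: of_nat_max)
  from divide_right_mono[OF this absv_nonneg[of q]]
  have "absv (p + s) / absv q \<le> max (absv p / absv q) (absv s / absv q)"
    by (simp add: max_divide_distrib_right)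
  moreover have "x + y = (p + s) / q" using pq by (simp add: add_divide_distrib)
  ultimately show ?thesis using pq by (simp add: absv_divide)
qed

text \<open>Over a common denominator the smaller numerator lies in \<open>filt (N - 1)\<close>,
  below the leading monomial of the other one.\<close>

lemma lead_add:
  assumes "absv y < absv x"
  shows "lcoeff (x + y) = lcoeff x" "absv (x + y) = absv x"
proof -
  obtain p s q where pq: "p \<in> pols" "s \<in> pols" "q \<in> pols" "q \<noteq> 0" "x = p / q" "y = s / q"
    by (rule common_denominator)
  have x: "x \<noteq> 0" using assms absv_nonneg[of y] by (metis absv_0 not_le)
  obtain b L where q: "leading q b L" using pq by (blast elim: pols_leading)
  obtain a N where p: "leading p a N" using pq x by (metis div_0 pols_leading)
  obtain M where M: "absv s = of_nat M" "s \<in> filt M" using pq by (blast elim: pols_absv)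
  have "absv s < absv p"
    using assms pq absv_pos[of q] by (simp add: absv_divide divide_less_cancel)
  then have "M < N" using M leading_eq[OF p] by simp
  then have "M \<le> N - 1" by simp
  then have "s \<in> filt (N - 1)" using M(2) filt_mono by blast
  from lead_fracI[OF leading_add[OF p this] q] lead_fracI[OF p q]
  have "lead_frac (x + y) (a / b) (of_nat N / of_nat L)" "lead_frac x (a / b) (of_nat N / of_nat L)"
    using pq by (simp_all add: add_divide_distrib)
  then show "lcoeff (x + y) = lcoeff x" "absv (x + y) = absv x"
    by (simp_all add: lead_frac_eq)
qed

lemma absv_var: "i \<le> n \<Longrightarrow> absv (\<alpha> i) = of_nat (nth_prime i)"
  by (rule leading_eq(2)[OF leading_var])

lemma lcoeff_var: "i \<le> n \<Longrightarrow> lcoeff (\<alpha> i) = 1"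
  by (rule leading_eq(1)[OF leading_var])

lemma var_nz: "i \<le> n \<Longrightarrow> \<alpha> i \<noteq> 0"
  by (rule leading_nz[OF leading_var])

text \<open>Parity of the exponent of \<open>\<alpha> i\<close> in the leading monomial. These
  parities together determine the square class of that monomial.\<close>

definition even_deg :: "nat \<Rightarrow> 'e \<Rightarrow> bool" where
  "even_deg i x = even_at (nth_prime i) (absv x)"

lemma even_deg_mult: "x \<noteq> 0 \<Longrightarrow> y \<noteq> 0 \<Longrightarrow> even_deg i (x * y) \<longleftrightarrow> (even_deg i x \<longleftrightarrow> even_deg i y)"
  by (simp add: even_deg_def absv_mult even_at_mult)

lemma even_deg_leading:
  "leading p c N \<Longrightarrow> even_deg i p \<longleftrightarrow> even (multiplicity (nth_prime i) N)"
  using even_at_frac[of "nth_prime i" N 1] codes_pos[of N]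
  by (simp add: even_deg_def leading_eq) (simp add: leading_def)

lemma even_deg_var: "j \<le> n \<Longrightarrow> even_deg i (\<alpha> j) \<longleftrightarrow> i \<noteq> j"
  by (simp add: even_deg_leading[OF leading_var] multiplicity_nth_prime)

text \<open>All exponents in N are even, so N is a square, and halving them gives the monomial of y.
  Subtracting y^2 then lowers the degree of x.\<close>

lemma leading_square:
  assumes x: "leading x (d\<^sup>2) N" and even: "\<And>i. i \<le> n \<Longrightarrow> even_deg i x"
  obtains y L where "leading y d L" "N = L\<^sup>2" "x - y\<^sup>2 \<in> filt (N - 1)"
proof -
  have N: "N \<in> codes" "d \<noteq> 0" using x by (auto simp: leading_def)
  define L where "L = (\<Prod>p\<in>prime_factors N. p ^ (multiplicity p N div 2))"
  have "even (multiplicity p N)" if "p \<in> prime_factors N" for p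
  proof -
    have "p \<in> nth_prime ` {..n}" using that N unfolding codes_def by blast
    then obtain i where "i \<le> n" "p = nth_prime i" by blast
    with even[of i] show ?thesis by (simp add: even_deg_leading[OF x])
  qed
  then have "L\<^sup>2 = (\<Prod>p\<in>prime_factors N. p ^ multiplicity p N)"
    unfolding L_def prod_power_distrib by (intro prod.cong) (auto simp flip: power_mult)
  then have L: "N = L\<^sup>2" using prime_factorization_nat[OF codes_pos[OF N(1)]] by simp
  then have Lc: "L \<in> codes" using N codes_pos[OF N(1)]
    by (auto simp: codes_def power2_eq_square prime_factors_product)
  have "(\<iota> d * monom_of L)\<^sup>2 = \<iota> (d\<^sup>2) * monom_of N"
    using codes_pos[OF Lc] by (simp add: L power2_eq_square monom_of_mult \<iota>.hom_mult mult_ac)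
  then have "x - (\<iota> d * monom_of L)\<^sup>2 \<in> filt (N - 1)" using x by (simp add: leading_def)
  then show ?thesis using that leading_monom[OF Lc N(2)] L by blast
qed

end

section \<open>Planes in quadratic forms\<close>

text \<open>The value e = 1 describes a subform [1, c] and e = 0 the form x^2 + c y^2, so quadratic
  and bilinear subforms are treated together. Independence of u and w is required separately because
  the plane may be totally singular.\<close>

definition has_plane :: "'a::field \<Rightarrow> 'a \<Rightarrow> 'a mat \<Rightarrow> bool" where
  "has_plane e c B \<longleftrightarrow> (\<exists>u\<in>carrier_vec (dim_row B). \<exists>w\<in>carrier_vec (dim_row B). \<forall>x y.
    quad_eval B (x \<cdot>\<^sub>v u + y \<cdot>\<^sub>v w) = x\<^sup>2 + e * (x * y) + c * y\<^sup>2 \<and>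
    (x \<cdot>\<^sub>v u + y \<cdot>\<^sub>v w = 0\<^sub>v (dim_row B) \<longrightarrow> x = 0 \<and> y = 0))"

lemma has_planeI:
  assumes "B \<in> carrier_mat d d" "u \<in> carrier_vec d" "w \<in> carrier_vec d"
    and "\<And>x y. quad_eval B (x \<cdot>\<^sub>v u + y \<cdot>\<^sub>v w) = x\<^sup>2 + e * (x * y) + c * y\<^sup>2"
    and "\<And>x y. x \<cdot>\<^sub>v u + y \<cdot>\<^sub>v w = 0\<^sub>v d \<Longrightarrow> x = 0 \<and> y = 0"
  shows "has_plane e c B"
  unfolding has_plane_def using assms by (intro bexI[of _ u] bexI[of _ w]) auto

lemma has_planeE:
  assumes "has_plane e c B" "B \<in> carrier_mat d d"
  obtains u w where "u \<in> carrier_vec d" "w \<in> carrier_vec d"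
    "\<And>x y. quad_eval B (x \<cdot>\<^sub>v u + y \<cdot>\<^sub>v w) = x\<^sup>2 + e * (x * y) + c * y\<^sup>2"
    "\<And>x y. x \<cdot>\<^sub>v u + y \<cdot>\<^sub>v w = 0\<^sub>v d \<Longrightarrow> x = 0 \<and> y = 0"
proof -
  have "dim_row B = d" using assms(2) by simp
  with assms(1) that show ?thesis unfolding has_plane_def by metis
qed

lemma has_plane_image:
  fixes A B :: "'a::field mat"
  assumes "has_plane e c A" and A: "A \<in> carrier_mat d d" and B: "B \<in> carrier_mat m m"
    and T: "T \<in> carrier_mat m d"
    and q: "\<And>v. v \<in> carrier_vec d \<Longrightarrow> quad_eval B (T *\<^sub>v v) = quad_eval A v"
    and inj: "\<And>v. v \<in> carrier_vec d \<Longrightarrow> T *\<^sub>v v = 0\<^sub>v m \<Longrightarrow> v = 0\<^sub>v d"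
  shows "has_plane e c B"
proof -
  obtain u w where uw: "u \<in> carrier_vec d" "w \<in> carrier_vec d"
    "\<And>x y. quad_eval A (x \<cdot>\<^sub>v u + y \<cdot>\<^sub>v w) = x\<^sup>2 + e * (x * y) + c * y\<^sup>2"
    "\<And>x y. x \<cdot>\<^sub>v u + y \<cdot>\<^sub>v w = 0\<^sub>v d \<Longrightarrow> x = 0 \<and> y = 0"
    using has_planeE[OF assms(1) A] by blast
  have lin: "x \<cdot>\<^sub>v (T *\<^sub>v u) + y \<cdot>\<^sub>v (T *\<^sub>v w) = T *\<^sub>v (x \<cdot>\<^sub>v u + y \<cdot>\<^sub>v w)" for x y
    using T uw(1,2)
    by (simp add: mult_add_distrib_mat_vec[OF T] mult_mat_vec[OF T])
  show ?thesis
  proof (rule has_planeI[OF B])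
    show "T *\<^sub>v u \<in> carrier_vec m" "T *\<^sub>v w \<in> carrier_vec m"
      using T uw(1,2) by auto
    show "quad_eval B (x \<cdot>\<^sub>v (T *\<^sub>v u) + y \<cdot>\<^sub>v (T *\<^sub>v w)) = x\<^sup>2 + e * (x * y) + c * y\<^sup>2" for x y
      unfolding lin using uw by (simp add: q)
    show "x = 0 \<and> y = 0" if "x \<cdot>\<^sub>v (T *\<^sub>v u) + y \<cdot>\<^sub>v (T *\<^sub>v w) = 0\<^sub>v m" for x y
      using inj[OF _ that[unfolded lin]] uw(1,2,4) by simp
  qed
qed

lemma has_plane_isometric:
  fixes A B :: "'a::field mat"
  assumes "isometric A B" "has_plane e c A" "A \<in> ns_forms" "B \<in> ns_forms"
  shows "has_plane e c B"
proof -
  obtain d where A: "A \<in> carrier_mat d d" using assms(3) by (rule ns_obtain)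
  have B: "B \<in> carrier_mat d d"
    using isometric_dim[OF assms(1)] A by (intro ns_carrier[OF assms(4)]) simp
  obtain T where T: "T \<in> carrier_mat d d" "invertible_mat T"
    "\<And>v. v \<in> carrier_vec d \<Longrightarrow> quad_eval B (T *\<^sub>v v) = quad_eval A v"
    using isometricE[OF assms(1) A] by blast
  obtain U where U: "U \<in> carrier_mat d d" "U * T = 1\<^sub>m d"
    using invertible_obtain[OF T(1,2)] by blast
  show ?thesis
  proof (rule has_plane_image[OF assms(2) A B T(1,3)])
    fix v :: "'a vec" assume v: "v \<in> carrier_vec d" "T *\<^sub>v v = 0\<^sub>v d"
    have "v = U *\<^sub>v (T *\<^sub>v v)"
      using assoc_mult_mat_vec[OF U(1) T(1) v(1)] U(2) v(1) by simp
    also have "\<dots> = 0\<^sub>v d" unfolding v(2) using U(1) by (intro eq_vecI) auto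
    finally show "v = 0\<^sub>v d" .
  qed
qed

lemma has_plane_subform:
  fixes B :: "'a::field mat"
  assumes "subform (mat_of_rows_list 2 [[1, e], [0, c]]) B" and B: "B \<in> carrier_mat d d"
  shows "has_plane e c B"
proof -
  let ?A = "mat_of_rows_list 2 [[1, e], [0, c]]"
  have A: "?A \<in> carrier_mat 2 2" by (rule carrier_matI) (simp_all add: mat_of_rows_list_def)
  have dims: "dim_row ?A = 2" "dim_row B = d" using A B by auto
  obtain T where T: "T \<in> carrier_mat d 2" "inj_on (\<lambda>v. T *\<^sub>v v) (carrier_vec 2)"
    "\<And>v. v \<in> carrier_vec 2 \<Longrightarrow> quad_eval B (T *\<^sub>v v) = quad_eval ?A v"
    using assms(1) unfolding subform_def dims by blast
  have vec: "x \<cdot>\<^sub>v unit_vec 2 0 + y \<cdot>\<^sub>v unit_vec 2 1 = vCons x (vCons y vNil)" for x y :: 'a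
    by (rule vec_2_eqI) auto
  have "has_plane e c ?A"
  proof (rule has_planeI[OF A unit_vec_carrier unit_vec_carrier])
    show "quad_eval ?A (x \<cdot>\<^sub>v unit_vec 2 0 + y \<cdot>\<^sub>v unit_vec 2 1) = x\<^sup>2 + e * (x * y) + c * y\<^sup>2" for x y
      unfolding vec by (simp add: quad_eval_2)
    show "x = 0 \<and> y = 0" if "x \<cdot>\<^sub>v unit_vec 2 0 + y \<cdot>\<^sub>v unit_vec 2 1 = 0\<^sub>v 2" for x y :: 'a
      using arg_cong[OF that, of "\<lambda>v. v $ 0"] arg_cong[OF that, of "\<lambda>v. v $ 1"] unfolding vec by simp
  qed
  then show ?thesis
  proof (rule has_plane_image[OF _ A B T(1,3)])
    fix v :: "'a vec" assume v: "v \<in> carrier_vec 2" "T *\<^sub>v v = 0\<^sub>v d"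
    have "T *\<^sub>v 0\<^sub>v 2 = 0\<^sub>v d" using T(1) by (intro eq_vecI) auto
    then show "v = 0\<^sub>v 2" using inj_onD[OF T(2), of v "0\<^sub>v 2"] v by simp
  qed
qed

lemma smult_append_vec: "x \<cdot>\<^sub>v (v @\<^sub>v w) = (x \<cdot>\<^sub>v v) @\<^sub>v (x \<cdot>\<^sub>v w)"
  by (intro eq_vecI) auto

lemma append_vec_eq_zero_iff:
  assumes "v \<in> carrier_vec d" "w \<in> carrier_vec m"
  shows "v @\<^sub>v w = 0\<^sub>v (d + m) \<longleftrightarrow> v = 0\<^sub>v d \<and> w = 0\<^sub>v m"
  unfolding append_zero_vec[symmetric] using assms by (intro append_vec_eq) auto

text \<open>The binary form [1, a] survives as the first orthogonal summand in every step of the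
  recursion.\<close>

lemma has_plane_qpfister: "has_plane 1 a (qpfister bs a)"
proof (induction bs)
  case Nil
  have vec: "x \<cdot>\<^sub>v unit_vec 2 0 + y \<cdot>\<^sub>v unit_vec 2 1 = vCons x (vCons y vNil)" for x y :: 'a
    by (rule vec_2_eqI) auto
  show ?case unfolding qpfister_Nil
  proof (rule has_planeI[OF binary_form_carrier unit_vec_carrier unit_vec_carrier])
    show "quad_eval (binary_form 1 a) (x \<cdot>\<^sub>v unit_vec 2 0 + y \<cdot>\<^sub>v unit_vec 2 1) = x\<^sup>2 + 1 * (x * y) + a * y\<^sup>2" for x y
      unfolding vec by (simp add: quad_eval_binary)
    show "x = 0 \<and> y = 0" if "x \<cdot>\<^sub>v unit_vec 2 0 + y \<cdot>\<^sub>v unit_vec 2 1 = 0\<^sub>v 2" for x y :: 'a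
      using arg_cong[OF that, of "\<lambda>v. v $ 0"] arg_cong[OF that, of "\<lambda>v. v $ 1"] unfolding vec by simp
  qed
next
  case (Cons b bs)
  define d :: nat where "d = 2 ^ Suc (length bs)"
  have A: "qpfister bs a \<in> carrier_mat d d" "b \<cdot>\<^sub>m qpfister bs a \<in> carrier_mat d d"
    unfolding d_def using qpfister_carrier[of bs a] by auto
  \<comment> \<open>The inclusion of the first summand, written with right-hand blocks of width 0 in
    order to be a block matrix.\<close>
  let ?T = "four_block_mat (1\<^sub>m d) (0\<^sub>m d 0) (0\<^sub>m d d) (0\<^sub>m d 0) :: 'a mat"
  have T: "?T \<in> carrier_mat (d + d) d" by (rule carrier_matI) simp_all
  have Tv: "?T *\<^sub>v v = v @\<^sub>v 0\<^sub>v d" if v: "v \<in> carrier_vec d" for v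
  proof -
    have "v = v @\<^sub>v 0\<^sub>v 0" by (intro eq_vecI) auto
    then have "?T *\<^sub>v v = ?T *\<^sub>v (v @\<^sub>v 0\<^sub>v 0)" by simp
    also have "\<dots> = v @\<^sub>v 0\<^sub>v d"
      by (subst four_block_mat_mult_vec[of _ d d _ 0 _ d]) (use v in auto)
    finally show ?thesis .
  qed
  show ?case unfolding qpfister_Cons
  proof (rule has_plane_image[OF Cons A(1) orth_sum_carrier[OF A] T])
    fix v :: "'a vec" assume v: "v \<in> carrier_vec d"
    then show "quad_eval (orth_sum (qpfister bs a) (b \<cdot>\<^sub>m qpfister bs a)) (?T *\<^sub>v v) = quad_eval (qpfister bs a) v"
      unfolding Tv[OF v] using A by (simp add: quad_eval_orth_sum[of _ d _ d])
    show "v = 0\<^sub>v d" if "?T *\<^sub>v v = 0\<^sub>v (d + d)"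
      using that v unfolding Tv[OF v] by (simp add: append_vec_eq_zero_iff)
  qed
qed

text \<open>A vector of value 1 in \<open>qpfister bs a\<close> has copies in the two summands; they
  are orthogonal and have the values 1 and b.\<close>

lemma has_plane_qpfister_slot: "has_plane 0 b (qpfister (b # bs) a)"
proof -
  define d :: nat where "d = 2 ^ Suc (length bs)"
  have A: "qpfister bs a \<in> carrier_mat d d" "b \<cdot>\<^sub>m qpfister bs a \<in> carrier_mat d d"
    unfolding d_def using qpfister_carrier[of bs a] by auto
  obtain u w where uw: "u \<in> carrier_vec d" "w \<in> carrier_vec d"
    "\<And>x y. quad_eval (qpfister bs a) (x \<cdot>\<^sub>v u + y \<cdot>\<^sub>v w) = x\<^sup>2 + 1 * (x * y) + a * y\<^sup>2"
    "\<And>x y. x \<cdot>\<^sub>v u + y \<cdot>\<^sub>v w = 0\<^sub>v d \<Longrightarrow> x = 0 \<and> y = 0"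
    using has_planeE[OF has_plane_qpfister A(1)] by blast
  have w0: "x \<cdot>\<^sub>v u + 0 \<cdot>\<^sub>v w = x \<cdot>\<^sub>v u" for x using uw(1,2) by (intro eq_vecI) auto
  have u: "quad_eval (qpfister bs a) (x \<cdot>\<^sub>v u) = x\<^sup>2" "x \<cdot>\<^sub>v u = 0\<^sub>v d \<Longrightarrow> x = 0" for x
    using uw(3)[of x 0] uw(4)[of x 0] unfolding w0 by simp_all
  have lin: "x \<cdot>\<^sub>v (u @\<^sub>v 0\<^sub>v d) + y \<cdot>\<^sub>v (0\<^sub>v d @\<^sub>v u) = (x \<cdot>\<^sub>v u) @\<^sub>v (y \<cdot>\<^sub>v u)" for x y
    unfolding smult_append_vec using uw(1) by (subst append_vec_add[of _ d _ _ d]) auto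
  show ?thesis unfolding qpfister_Cons
  proof (rule has_planeI[OF orth_sum_carrier[OF A], of "u @\<^sub>v 0\<^sub>v d" "0\<^sub>v d @\<^sub>v u"])
    show "quad_eval (orth_sum (qpfister bs a) (b \<cdot>\<^sub>m qpfister bs a)) (x \<cdot>\<^sub>v (u @\<^sub>v 0\<^sub>v d) + y \<cdot>\<^sub>v (0\<^sub>v d @\<^sub>v u))
      = x\<^sup>2 + 0 * (x * y) + b * y\<^sup>2" for x y
      unfolding lin using A uw(1)
      by (simp add: quad_eval_orth_sum[of _ d _ d] quad_eval_smult_mat[of _ d] u)
    show "x = 0 \<and> y = 0" if "x \<cdot>\<^sub>v (u @\<^sub>v 0\<^sub>v d) + y \<cdot>\<^sub>v (0\<^sub>v d @\<^sub>v u) = 0\<^sub>v (d + d)" for x y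
      using that uw(1) u(2) unfolding lin by (simp add: append_vec_eq_zero_iff)
  qed (use uw in auto)
qed

section \<open>Values of the Pfister forms\<close>

context rational_functions
begin

text \<open>\<open>J\<close> is the set of variables in the form, and \<open>R\<close> those not yet
  used as a bilinear slot. The latter enter only through the last slot, where they occur together,
  so the leading monomials of the values have the same parity in all of them.\<close>

definition good_val :: "nat set \<Rightarrow> nat set \<Rightarrow> 'e \<Rightarrow> bool" where
  "good_val J R x \<longleftrightarrow> x \<noteq> 0 \<and> (\<exists>d. lcoeff x = d\<^sup>2) \<and> (\<forall>i. i \<le> n \<longrightarrow> i \<notin> J \<longrightarrow> even_deg i x) \<and>
    (\<forall>i\<in>R. \<forall>j\<in>R. even_deg i x \<longleftrightarrow> even_deg j x)"

lemma good_val_nz: "good_val J R x \<Longrightarrow> x \<noteq> 0"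
  by (simp only: good_val_def simp_thms)

lemma good_val_even: "good_val J R x \<Longrightarrow> i \<le> n \<Longrightarrow> i \<notin> J \<Longrightarrow> even_deg i x"
  unfolding good_val_def by blast

lemma good_val_even_eq: "good_val J R x \<Longrightarrow> i \<in> R \<Longrightarrow> j \<in> R \<Longrightarrow> even_deg i x = even_deg j x"
  unfolding good_val_def by blast

lemma good_val_add:
  assumes "good_val J R x" "absv y < absv x"
  shows "good_val J R (x + y)"
proof -
  have "x + y \<noteq> 0" using lead_add(2)[OF assms(2)] good_val_nz[OF assms(1)] absv_eq_0 by metis
  moreover have "even_deg i (x + y) = even_deg i x" for i
    by (simp add: even_deg_def lead_add(2)[OF assms(2)])
  ultimately show ?thesis
    using assms(1) unfolding good_val_def lead_add(1)[OF assms(2)] by blast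
qed

lemma even_deg_square: "x \<noteq> 0 \<Longrightarrow> even_deg i (x\<^sup>2)"
  by (simp add: power2_eq_square even_deg_mult)

lemma good_val_square: "x \<noteq> 0 \<Longrightarrow> good_val J R (x\<^sup>2)"
  by (auto simp: good_val_def even_deg_square) (metis lcoeff_mult power2_eq_square)

lemma good_val_mono: "good_val J R x \<Longrightarrow> R' \<subseteq> R \<Longrightarrow> good_val J R' x"
  unfolding good_val_def by blast

text \<open>The factor changes the parity at \<open>m\<close> and at no other index, so only
  \<open>m\<close> has to leave \<open>R\<close>.\<close>

lemma good_val_mult_var:
  assumes "good_val J R x" "m \<in> J" "m \<le> n"
  shows "good_val J (R - {m}) (\<alpha> m * x)"
proof -
  have nz: "\<alpha> m \<noteq> 0" "x \<noteq> 0" using var_nz[OF assms(3)] good_val_nz[OF assms(1)] .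
  have even: "even_deg i (\<alpha> m * x) \<longleftrightarrow> even_deg i x" if "i \<noteq> m" for i
    using that nz assms(3) by (simp add: even_deg_mult even_deg_var)
  have "lcoeff (\<alpha> m * x) = lcoeff x" using nz assms(3) by (simp add: lcoeff_mult lcoeff_var)
  moreover have "even_deg i (\<alpha> m * x)" if "i \<le> n" "i \<notin> J" for i
    using that even[of i] assms good_val_even by blast
  moreover have "even_deg i (\<alpha> m * x) \<longleftrightarrow> even_deg j (\<alpha> m * x)" if "i \<in> R - {m}" "j \<in> R - {m}" for i j
    using that even[of i] even[of j] good_val_even_eq[OF assms(1), of i j] by simp
  ultimately show ?thesis
    using nz assms(1) unfolding good_val_def mult_eq_0_iff by (simp only: simp_thms) blast
qed

lemma prod_var:
  assumes "J \<subseteq> {..n}"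
  shows "prod \<alpha> J \<noteq> 0" "lcoeff (prod \<alpha> J) = 1" "even_deg i (prod \<alpha> J) \<longleftrightarrow> i \<notin> J"
    "J \<noteq> {} \<Longrightarrow> absv (prod \<alpha> J) \<ge> 2"
proof -
  have "finite J" using assms finite_subset by blast
  then have "prod \<alpha> J \<noteq> 0 \<and> lcoeff (prod \<alpha> J) = 1 \<and> (\<forall>i. even_deg i (prod \<alpha> J) \<longleftrightarrow> i \<notin> J) \<and>
     absv (prod \<alpha> J) \<ge> 1 \<and> (J \<noteq> {} \<longrightarrow> absv (prod \<alpha> J) \<ge> 2)"
    using assms
  proof induction
    case empty
    show ?case using leading_eq[OF leading_1] even_deg_leading[OF leading_1] by simp
  next
    case (insert j J)
    have "absv (\<alpha> j) \<ge> 2"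
      using insert.prems prime_ge_2_nat[OF prime_nth_prime[of j]] by (simp add: absv_var)
    moreover have "absv (prod \<alpha> J) \<ge> 1" using insert by simp
    ultimately have "2 * 1 \<le> absv (\<alpha> j) * absv (prod \<alpha> J)" by (intro mult_mono) auto
    then show ?case
      using insert by (auto simp: var_nz lcoeff_mult lcoeff_var even_deg_mult even_deg_var absv_mult)
  qed
  then show "prod \<alpha> J \<noteq> 0" "lcoeff (prod \<alpha> J) = 1" "even_deg i (prod \<alpha> J) \<longleftrightarrow> i \<notin> J"
    "J \<noteq> {} \<Longrightarrow> absv (prod \<alpha> J) \<ge> 2" by auto
qed

lemma good_val_prod:
  assumes "J \<subseteq> {..n}" "y \<noteq> 0"
  shows "good_val J J (prod \<alpha> J * y\<^sup>2)"
  using assms prod_var[OF assms(1)] lcoeff_mult[of y y]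
  by (auto simp: good_val_def even_deg_mult even_deg_square lcoeff_mult power2_eq_square)

lemma absv_le_0 [simp]: "absv x \<le> 0 \<longleftrightarrow> x = 0"
  using absv_nonneg[of x] by (metis absv_eq_0 order_antisym order_refl)

lemma absv_add_eq_max:
  assumes "x \<noteq> 0 \<Longrightarrow> y \<noteq> 0 \<Longrightarrow> absv x \<noteq> absv y"
  shows "absv (x + y) = max (absv x) (absv y)"
proof (cases "x = 0 \<or> y = 0")
  case False
  with assms consider "absv y < absv x" | "absv x < absv y" by fastforce
  then show ?thesis
    using lead_add(2)[of y x] lead_add(2)[of x y] by cases (auto simp: add.commute)
qed (auto simp: max_def order_antisym)

text \<open>
  The inequality says that the polar form is small compared with the values; this is what excludes
  a subform \<open>[1, c]\<close> with a small \<open>c\<close>.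
\<close>

definition good_form :: "nat set \<Rightarrow> nat set \<Rightarrow> 'e mat \<Rightarrow> bool" where
  "good_form J R A \<longleftrightarrow>
    (\<forall>v\<in>carrier_vec (dim_row A). v \<noteq> 0\<^sub>v (dim_row A) \<longrightarrow> good_val J R (quad_eval A v)) \<and>
    (\<forall>v\<in>carrier_vec (dim_row A). \<forall>w\<in>carrier_vec (dim_row A).
      2 * (absv (polar A v w))\<^sup>2 \<le> absv (quad_eval A v) * absv (quad_eval A w))"

text \<open>The terms x^2 and a y^2 differ in parity at every index of \<open>J\<close>, hence in
  absolute value, and x y is smaller than the larger of them because the absolute value of a is at
  least 2. So the value is dominated by a single diagonal term.\<close>

lemma good_form_binary:
  assumes two: "(2::'e) = 0" and J: "J \<subseteq> {..n}" "J \<noteq> {}"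
  shows "good_form J J (binary_form 1 (prod \<alpha> J))"
proof -
  define a where "a = prod \<alpha> J"
  define g where "g = absv a"
  have g: "g \<ge> 2" "a \<noteq> 0" using prod_var[OF J(1)] J by (auto simp: g_def a_def)
  have gg: "absv (a * y\<^sup>2) = g * (absv y)\<^sup>2" for y by (simp add: g_def absv_mult absv_power)
  have ne: "absv (x\<^sup>2) \<noteq> absv (a * y\<^sup>2)" if "x \<noteq> 0" "y \<noteq> 0" for x y
  proof -
    obtain j where j: "j \<in> J" using J by auto
    have "even_deg j (x\<^sup>2)" "\<not> even_deg j (a * y\<^sup>2)"
      using that g prod_var(3)[OF J(1), of j] j by (auto simp: even_deg_mult even_deg_square a_def)
    then show ?thesis by (auto simp: even_deg_def)
  qed
  have small: "absv (x * y) < max (absv (x\<^sup>2)) (absv (a * y\<^sup>2))" if "x \<noteq> 0" "y \<noteq> 0" for x y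
  proof -
    have x: "absv x > 0" and y: "absv y > 0" using that by auto
    show ?thesis
    proof (cases "absv y < absv x")
      case True
      then show ?thesis using x by (simp add: absv_mult absv_power power2_eq_square less_max_iff_disj)
    next
      case False
      then have "absv x * absv y \<le> absv y * absv y" using y by (intro mult_right_mono) auto
      also have "\<dots> < g * (absv y * absv y)" using g y by (simp add: mult_less_cancel_right2)
      finally show ?thesis by (simp add: g_def absv_mult power2_eq_square less_max_iff_disj)
    qed
  qed
  have val: "(x \<noteq> 0 \<or> y \<noteq> 0 \<longrightarrow> good_val J J (x\<^sup>2 + x * y + a * y\<^sup>2)) \<and>
    absv (x\<^sup>2 + x * y + a * y\<^sup>2) = max (absv (x\<^sup>2)) (absv (a * y\<^sup>2))" for x y
  proof (cases "x = 0 \<or> y = 0")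
    case True
    then show ?thesis
      using good_val_square[of x J J] good_val_prod[OF J(1), of y] by (auto simp: a_def max_def order_antisym)
  next
    case False
    then have nz: "x \<noteq> 0" "y \<noteq> 0" by auto
    consider "absv (a * y\<^sup>2) < absv (x\<^sup>2)" | "absv (x\<^sup>2) < absv (a * y\<^sup>2)"
      using ne[OF nz] by fastforce
    then show ?thesis
    proof cases
      case 1
      then have lt: "absv (x * y + a * y\<^sup>2) < absv (x\<^sup>2)"
        using small[OF nz] absv_add[of "x * y" "a * y\<^sup>2"] by (auto simp: max_def split: if_splits)
      then show ?thesis
        using 1 good_val_add[OF good_val_square[OF nz(1)] lt] lead_add(2)[OF lt] by (simp add: add.assoc)
    next
      case 2
      then have lt: "absv (x\<^sup>2 + x * y) < absv (a * y\<^sup>2)"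
        using small[OF nz] absv_add[of "x\<^sup>2" "x * y"] by (auto simp: max_def split: if_splits)
      then show ?thesis
        using 2 good_val_add[OF good_val_prod[OF J(1) nz(2)], folded a_def, OF lt] lead_add(2)[OF lt]
        by (simp add: add.commute)
    qed
  qed
  have q: "quad_eval (binary_form 1 a) v = (v $ 0)\<^sup>2 + v $ 0 * v $ 1 + a * (v $ 1)\<^sup>2"
    if "v \<in> carrier_vec 2" for v
    using that by (simp add: quad_eval_binary)
  have mixed: "2 * (absv (x * y'))\<^sup>2 \<le> absv (x\<^sup>2 + x * y + a * y\<^sup>2) * absv (x'\<^sup>2 + x' * y' + a * y'\<^sup>2)"
    for x y x' y'
  proof -
    \<comment> \<open>The rational constant 2 in \<open>good_form\<close>, which makes the bound on
      the polar form strict for nonzero vectors, comes from \<open>g \<ge> 2\<close>.\<close>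
    have "2 * (absv (x * y'))\<^sup>2 \<le> g * (absv (x * y'))\<^sup>2" using g by (intro mult_right_mono) auto
    also have "\<dots> = absv (x\<^sup>2) * absv (a * y'\<^sup>2)"
      by (simp add: g_def absv_mult absv_power power2_eq_square)
    also have "\<dots> \<le> max (absv (x\<^sup>2)) (absv (a * y\<^sup>2)) * max (absv (x'\<^sup>2)) (absv (a * y'\<^sup>2))"
      by (intro mult_mono) (auto simp: le_max_iff_disj)
    finally show ?thesis using val by simp
  qed
  show ?thesis
    unfolding good_form_def a_def[symmetric] dim_row_binary_form
  proof (intro conjI ballI impI)
    fix v :: "'e vec" assume v: "v \<in> carrier_vec 2" "v \<noteq> 0\<^sub>v 2"
    then have "v $ 0 \<noteq> 0 \<or> v $ 1 \<noteq> 0" using vec_2_eqI[of v "0\<^sub>v 2"] by auto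
    then show "good_val J J (quad_eval (binary_form 1 a) v)" using val q[OF v(1)] by simp
  next
    fix v w :: "'e vec" assume v: "v \<in> carrier_vec 2" and w: "w \<in> carrier_vec 2"
    have "absv (polar (binary_form 1 a) v w) \<le> max (absv (v $ 0 * w $ 1)) (absv (w $ 0 * v $ 1))"
      using absv_add[of "v $ 0 * w $ 1" "w $ 0 * v $ 1"] by (simp add: polar_binary[OF v w] two mult.commute)
    then have "2 * (absv (polar (binary_form 1 a) v w))\<^sup>2 \<le> max (2 * (absv (v $ 0 * w $ 1))\<^sup>2) (2 * (absv (w $ 0 * v $ 1))\<^sup>2)"
      by (auto simp: le_max_iff_disj intro!: power_mono)
    also have "\<dots> \<le> absv (quad_eval (binary_form 1 a) v) * absv (quad_eval (binary_form 1 a) w)"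
      using mixed[of "v $ 0" "w $ 1" "v $ 1" "w $ 0"] mixed[of "w $ 0" "v $ 1" "w $ 1" "v $ 0"]
      by (simp add: q v w mult.commute)
    finally show "2 * (absv (polar (binary_form 1 a) v w))\<^sup>2
      \<le> absv (quad_eval (binary_form 1 a) v) * absv (quad_eval (binary_form 1 a) w)" .
  qed
qed

text \<open>The index \<open>k\<close> remains in \<open>R\<close> for comparison: nonzero values of
  A have equal parity at m and k, those of the second summand have different parity. So the two
  never have the same absolute value, the larger one dominates, and the polar inequality follows
  from that of each summand.\<close>

lemma good_form_orth_sum:
  assumes A: "A \<in> carrier_mat d d" "good_form J R A"
    and R: "m \<in> R" "k \<in> R" "k \<noteq> m" "m \<in> J" "m \<le> n"
  shows "good_form J (R - {m}) (orth_sum A (\<alpha> m \<cdot>\<^sub>m A))"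
proof -
  let ?B = "\<alpha> m \<cdot>\<^sub>m A"
  have B: "?B \<in> carrier_mat d d" using A by simp
  have dim: "dim_row (orth_sum A ?B) = d + d" "dim_row A = d" using A by simp_all
  have A1: "good_val J R (quad_eval A v)" if "v \<in> carrier_vec d" "v \<noteq> 0\<^sub>v d" for v
    using A that by (auto simp: good_form_def)
  have A2: "2 * (absv (polar A v w))\<^sup>2 \<le> absv (quad_eval A v) * absv (quad_eval A w)"
    if "v \<in> carrier_vec d" "w \<in> carrier_vec d" for v w
    using A that by (auto simp: good_form_def)
  have zero: "quad_eval A (0\<^sub>v d) = 0" using A by simp
  have ne: "absv (quad_eval A v) \<noteq> absv (\<alpha> m * quad_eval A w)"
    if "v \<in> carrier_vec d" "w \<in> carrier_vec d" "v \<noteq> 0\<^sub>v d" "w \<noteq> 0\<^sub>v d" for v w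
  proof -
    have v: "even_deg m (quad_eval A v) = even_deg k (quad_eval A v)"
      using good_val_even_eq[OF A1] that R by blast
    have w: "even_deg m (quad_eval A w) = even_deg k (quad_eval A w)" "quad_eval A w \<noteq> 0"
      using good_val_even_eq[OF A1] good_val_nz[OF A1] that R by blast+
    have "even_deg m (\<alpha> m * quad_eval A w) \<noteq> even_deg k (\<alpha> m * quad_eval A w)"
      using w R by (simp add: even_deg_mult var_nz even_deg_var)
    with v show ?thesis by (auto simp: even_deg_def)
  qed
  have q: "quad_eval (orth_sum A ?B) (v @\<^sub>v w) = quad_eval A v + \<alpha> m * quad_eval A w"
    if "v \<in> carrier_vec d" "w \<in> carrier_vec d" for v w
    using that A B by (simp add: quad_eval_orth_sum[of _ d _ d] quad_eval_smult_mat[of _ d])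
  have max: "absv (quad_eval (orth_sum A ?B) (v @\<^sub>v w))
      = max (absv (quad_eval A v)) (absv (\<alpha> m * quad_eval A w))"
    if "v \<in> carrier_vec d" "w \<in> carrier_vec d" for v w
    unfolding q[OF that] using ne[OF that] zero by (intro absv_add_eq_max) auto
  show ?thesis
    unfolding good_form_def dim
  proof (intro conjI ballI impI)
    fix x :: "'e vec" assume x: "x \<in> carrier_vec (d + d)" "x \<noteq> 0\<^sub>v (d + d)"
    obtain v w where vw: "v \<in> carrier_vec d" "w \<in> carrier_vec d" "x = v @\<^sub>v w"
      using x(1) by (rule vec_append_cases)
    have nz: "v \<noteq> 0\<^sub>v d \<or> w \<noteq> 0\<^sub>v d" using x vw by (auto simp: append_zero_vec)
    have gv: "good_val J (R - {m}) (quad_eval A v)" if "v \<noteq> 0\<^sub>v d"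
      using good_val_mono[OF A1[OF vw(1) that]] by auto
    have gw: "good_val J (R - {m}) (\<alpha> m * quad_eval A w)" if "w \<noteq> 0\<^sub>v d"
      using good_val_mult_var[OF A1[OF vw(2) that]] R by auto
    show "good_val J (R - {m}) (quad_eval (orth_sum A ?B) x)"
    proof (cases "v = 0\<^sub>v d \<or> w = 0\<^sub>v d")
      case True
      then show ?thesis using nz gv gw unfolding vw(3) q[OF vw(1,2)] by (auto simp: zero)
    next
      case False
      then consider "absv (quad_eval A v) < absv (\<alpha> m * quad_eval A w)"
        | "absv (\<alpha> m * quad_eval A w) < absv (quad_eval A v)"
        using ne[OF vw(1,2)] by fastforce
      then show ?thesis
      proof cases
        case 1
        with good_val_add[OF gw 1] False show ?thesis
          unfolding vw(3) q[OF vw(1,2)] by (simp add: add.commute)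
      next
        case 2
        with good_val_add[OF gv 2] False show ?thesis
          unfolding vw(3) q[OF vw(1,2)] by simp
      qed
    qed
  next
    fix x x' :: "'e vec" assume x: "x \<in> carrier_vec (d + d)" and x': "x' \<in> carrier_vec (d + d)"
    obtain v w where vw: "v \<in> carrier_vec d" "w \<in> carrier_vec d" "x = v @\<^sub>v w"
      using x by (rule vec_append_cases)
    obtain v' w' where vw': "v' \<in> carrier_vec d" "w' \<in> carrier_vec d" "x' = v' @\<^sub>v w'"
      using x' by (rule vec_append_cases)
    have "polar (orth_sum A ?B) x x' = polar A v v' + \<alpha> m * polar A w w'"
      unfolding vw(3) vw'(3) using A B vw vw'
      by (simp add: polar_orth_sum[of _ d _ d] polar_smult_mat[of _ d])
    then have "absv (polar (orth_sum A ?B) x x') \<le> max (absv (polar A v v')) (absv (\<alpha> m * polar A w w'))"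
      by (simp add: absv_add)
    then have "2 * (absv (polar (orth_sum A ?B) x x'))\<^sup>2
        \<le> max (2 * (absv (polar A v v'))\<^sup>2) (2 * (absv (\<alpha> m * polar A w w'))\<^sup>2)"
      by (auto simp: le_max_iff_disj intro!: power_mono)
    also have "\<dots> \<le> absv (quad_eval (orth_sum A ?B) x) * absv (quad_eval (orth_sum A ?B) x')"
    proof (rule max.boundedI)
      show "2 * (absv (polar A v v'))\<^sup>2 \<le> absv (quad_eval (orth_sum A ?B) x) * absv (quad_eval (orth_sum A ?B) x')"
        unfolding vw(3) vw'(3) max[OF vw(1,2)] max[OF vw'(1,2)]
        by (rule order_trans[OF A2[OF vw(1) vw'(1)]]) (intro mult_mono, auto simp: le_max_iff_disj)
      have "2 * (absv (\<alpha> m * polar A w w'))\<^sup>2 = (absv (\<alpha> m))\<^sup>2 * (2 * (absv (polar A w w'))\<^sup>2)"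
        by (simp add: absv_mult power_mult_distrib)
      also have "\<dots> \<le> (absv (\<alpha> m))\<^sup>2 * (absv (quad_eval A w) * absv (quad_eval A w'))"
        by (intro mult_left_mono A2 vw vw') auto
      also have "\<dots> = absv (\<alpha> m * quad_eval A w) * absv (\<alpha> m * quad_eval A w')"
        by (simp add: absv_mult power2_eq_square)
      also have "\<dots> \<le> absv (quad_eval (orth_sum A ?B) x) * absv (quad_eval (orth_sum A ?B) x')"
        unfolding vw(3) vw'(3) max[OF vw(1,2)] max[OF vw'(1,2)]
        by (intro mult_mono) (auto simp: le_max_iff_disj)
      finally show "2 * (absv (\<alpha> m * polar A w w'))\<^sup>2
        \<le> absv (quad_eval (orth_sum A ?B) x) * absv (quad_eval (orth_sum A ?B) x')" .
    qed
    finally show "2 * (absv (polar (orth_sum A ?B) x x'))\<^sup>2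
      \<le> absv (quad_eval (orth_sum A ?B) x) * absv (quad_eval (orth_sum A ?B) x')" .
  qed
qed

text \<open>The variable with index \<open>k\<close> never becomes a bilinear slot, so there is
  always an index to compare with.\<close>

lemma good_form_qpfister:
  assumes two: "(2::'e) = 0" and J: "J \<subseteq> {..n}" "k \<in> J" "k \<notin> set ls" "set ls \<subseteq> J" "distinct ls"
  shows "good_form J (J - set ls) (qpfister (map \<alpha> ls) (prod \<alpha> J))"
  using J(3-5)
proof (induction ls)
  case Nil
  then show ?case using good_form_binary[OF two J(1)] J(2) by (auto simp: qpfister_Nil)
next
  case (Cons m ls)
  have "good_form J (J - set ls - {m})
    (orth_sum (qpfister (map \<alpha> ls) (prod \<alpha> J)) (\<alpha> m \<cdot>\<^sub>m qpfister (map \<alpha> ls) (prod \<alpha> J)))"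
    by (rule good_form_orth_sum[OF qpfister_carrier, of _ _ _ _ _ k]) (use Cons J in auto)
  moreover have "J - set (m # ls) = J - set ls - {m}" by auto
  ultimately show ?case by (simp only: list.map qpfister_Cons)
qed

text \<open>
  A common plane of all the forms would only represent elements whose leading term is a square.
  Hence the value at \<open>(x, q)\<close> can be lowered indefinitely by changing the polynomial \<open>x\<close>.
\<close>

lemma no_common_plane:
  assumes two: "(2::'e) = 0"
    and B: "\<And>i. i \<le> n \<Longrightarrow> B i \<in> carrier_mat d d" "\<And>i. i \<le> n \<Longrightarrow> good_form ({..n} - {i}) (R i) (B i)"
    and plane: "\<And>i. i \<le> n \<Longrightarrow> has_plane e c (B i)"
    and e: "e \<in> pols"
  shows False
proof -
  obtain p q where pq: "p \<in> pols" "q \<in> pols" "q \<noteq> 0" "c = p / q" by (rule quotient_obtain)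
  \<comment> \<open>The value at (x, q); with the denominator of c as second coordinate it is a
    polynomial whenever x is one.\<close>
  define f where "f x = x\<^sup>2 + e * (x * q) + p * q" for x
  have f: "f x = x\<^sup>2 + e * (x * q) + c * q\<^sup>2" for x
    using pq by (simp add: f_def power2_eq_square)
  have f_pols: "f x \<in> pols" if "x \<in> pols" for x
    unfolding f_def using that pq e by (intro pols_add pols_mult pols_power)
  \<comment> \<open>The i-th form contributes the parity in \<open>\<alpha> i\<close>, the variable
    missing from it. Since the plane is common to all the forms, the values have even degree in
    every variable.\<close>
  have good: "f x \<noteq> 0 \<and> (\<exists>d. lcoeff (f x) = d\<^sup>2) \<and> even_deg i (f x) \<and> 2 * (absv (e * q))\<^sup>2 \<le> absv (f x)"
    if i: "i \<le> n" for i x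
  proof -
    obtain u w where uw: "u \<in> carrier_vec d" "w \<in> carrier_vec d"
      "\<And>x y. quad_eval (B i) (x \<cdot>\<^sub>v u + y \<cdot>\<^sub>v w) = x\<^sup>2 + e * (x * y) + c * y\<^sup>2"
      "\<And>x y. x \<cdot>\<^sub>v u + y \<cdot>\<^sub>v w = 0\<^sub>v d \<Longrightarrow> x = 0 \<and> y = 0"
      using has_planeE[OF plane[OF i] B(1)[OF i]] by blast
    have dim: "dim_row (B i) = d" using B(1)[OF i] by simp
    define v where "v = x \<cdot>\<^sub>v u + q \<cdot>\<^sub>v w"
    have v: "v \<in> carrier_vec d" "v \<noteq> 0\<^sub>v d" "quad_eval (B i) v = f x"
      using uw(1,2) uw(4)[of x q] pq(3) by (auto simp: v_def uw(3) f)
    have "1 \<cdot>\<^sub>v u + 0 \<cdot>\<^sub>v w = u" using uw(1,2) by (intro eq_vecI) auto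
    then have u: "quad_eval (B i) u = 1" using uw(3)[of 1 0] by simp
    have "u + v = (x + 1) \<cdot>\<^sub>v u + q \<cdot>\<^sub>v w"
      using uw(1,2) by (intro eq_vecI) (auto simp: v_def algebra_simps)
    \<comment> \<open>Pairing with the vector u of value 1 turns the inequality of
      \<open>good_form\<close> into a bound on the mixed coefficient e q.\<close>
    then have "polar (B i) u v = f (x + 1) - 1 - f x" by (simp add: polar_def u v uw(3) f)
    also have "\<dots> = 2 * x + e * q" by (simp add: f power2_eq_square algebra_simps)
    finally have "polar (B i) u v = e * q" using two by simp
    moreover have "absv 1 = 1" using absv_power[of 1 0] by simp
    moreover have "2 * (absv (polar (B i) u v))\<^sup>2 \<le> absv (quad_eval (B i) u) * absv (quad_eval (B i) v)"
      using B(2)[OF i] uw(1) v(1) unfolding good_form_def dim by blast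
    ultimately have "2 * (absv (e * q))\<^sup>2 \<le> absv (f x)" by (simp add: u v)
    moreover have gv: "good_val ({..n} - {i}) (R i) (f x)"
      using B(2)[OF i] v unfolding good_form_def dim by metis
    ultimately show ?thesis
      using gv i unfolding good_val_def by blast
  qed
  \<comment> \<open>The least degree of a value, over all polynomials x; the infinite descent takes
    the form of a minimal choice.\<close>
  define r where "r = (LEAST r. \<exists>x\<in>pols. f x \<in> filt r)"
  obtain r0 where "f 0 \<in> filt r0" using f_pols[OF pols_0] by (auto simp: pols_def)
  with pols_0 have "\<exists>r. \<exists>x\<in>pols. f x \<in> filt r" by blast
  then have "\<exists>x\<in>pols. f x \<in> filt r" unfolding r_def by (rule LeastI_ex)
  then obtain x where x: "x \<in> pols" "f x \<in> filt r" by blast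
  have least: "r \<le> s" if "y \<in> pols" "f y \<in> filt s" for y s
    unfolding r_def using that by (intro Least_le) blast
  obtain b N where lead: "leading (f x) b N" "N \<le> r"
    using leading_exists[OF x(2)] good[of 0 x] by auto
  then have N: "N = r" using least[OF x(1) leading_filt] by (simp add: order_antisym)
  obtain h where "b = h\<^sup>2" using good[of 0 x] leading_eq(1)[OF lead(1)] by auto
  then obtain y L where y: "leading y h L" "r = L\<^sup>2" "f x - y\<^sup>2 \<in> filt (r - 1)"
    using leading_square[of "f x" h N] lead good N by auto
  have L: "L > 0" using y(1) codes_pos by (auto simp: leading_def)
  obtain s where s: "absv (e * q) = of_nat s" "e * q \<in> filt s"
    using pols_mult[OF e pq(2)] by (blast elim: pols_absv)
  have "2 * (of_nat s)\<^sup>2 \<le> (of_nat (L\<^sup>2) :: rat)"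
    using good[of 0 x] leading_eq(2)[OF lead(1)] s(1) N y(2) by simp
  then have "of_nat (2 * s\<^sup>2) \<le> (of_nat (L\<^sup>2) :: rat)" by simp
  then have sL: "2 * s\<^sup>2 \<le> L\<^sup>2" by (simp only: of_nat_le_iff)
  \<comment> \<open>Hence the mixed term e q y has degree at most s L, which is below L^2 = r, and
    does not disturb the cancellation of y^2.\<close>
  have "s < L"
  proof (rule ccontr)
    assume "\<not> s < L"
    then have "L\<^sup>2 \<le> s\<^sup>2" by (simp add: power_mono)
    moreover have "0 < L\<^sup>2" using L by simp
    ultimately show False using sL by linarith
  qed
  then have "s * L < r" using L by (simp add: y(2) power2_eq_square)
  then have "s * L \<le> r - 1" by simp
  then have "e * q * y \<in> filt (r - 1)"
    using filt_mult[OF s(2) leading_filt[OF y(1)]] filt_mono by blast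
  then have "f x - y\<^sup>2 + e * q * y \<in> filt (r - 1)" using y(3) by (intro filt_add)
  \<comment> \<open>In characteristic two, moving x by y removes the leading term y^2.\<close>
  moreover have "f (x + y) = f x - y\<^sup>2 + e * q * y + 2 * (x * y + y\<^sup>2)"
    by (simp add: f_def power2_eq_square algebra_simps)
  ultimately have "f (x + y) \<in> filt (r - 1)" using two by simp
  moreover have "x + y \<in> pols" using pols_add[OF x(1) filt_pols[OF leading_filt[OF y(1)]]] .
  ultimately have "r \<le> r - 1" by (intro least)
  \<comment> \<open>Subtraction of natural numbers truncates, so \<open>r \<le> r - 1\<close> is
    contradictory only for positive r.\<close>
  moreover have "r > 0" using L y(2) by simp
  ultimately show False by simp
qed

section \<open>The forms with one variable omitted\<close>

definition omit :: "nat \<Rightarrow> nat list" where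
  "omit i = filter (\<lambda>j. j \<noteq> i) [0..<Suc n]"

text \<open>The first index of the list plays the role of y_1 in the form P of the introduction: its
  variable enters only the last slot, and the tail gives the bilinear slots.\<close>

definition omit_form :: "nat \<Rightarrow> 'e mat" where
  "omit_form i = qpfister (map \<alpha> (tl (omit i))) (prod \<alpha> ({..n} - {i}))"

lemma omit_props: "set (omit i) = {..n} - {i}" "distinct (omit i)" "i \<le> n \<Longrightarrow> length (omit i) = n"
proof -
  show 1: "set (omit i) = {..n} - {i}" and 2: "distinct (omit i)" by (auto simp: omit_def)
  show "i \<le> n \<Longrightarrow> length (omit i) = n" using distinct_card[OF 2] 1 by simp
qed

context
  assumes two: "(2::'e) = 0" and n: "n \<ge> 2"
begin

lemma omit_Cons:
  assumes "i \<le> n"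
  obtains k ls where "omit i = k # ls"
  using omit_props(3)[OF assms] n by (cases "omit i") auto

lemma omit_form_pfister:
  assumes "i \<le> n"
  shows "omit_form i \<in> quadratic_pfister_forms n"
proof -
  have "set (tl (omit i)) \<subseteq> {..n}" using omit_props(1)[of i] by (cases "omit i") auto
  then have "0 \<notin> set (map \<alpha> (tl (omit i)))" using var_nz by force
  moreover have "length (map \<alpha> (tl (omit i))) = n - 1" using omit_props(3)[OF assms] by simp
  ultimately show ?thesis unfolding quadratic_pfister_forms_eq omit_form_def by blast
qed

lemma pfister_ns: "quadratic_pfister_forms m \<subseteq> (ns_forms :: 'e mat set)"
  by (auto simp: quadratic_pfister_forms_eq qpfister_ns[OF two])

lemma omit_form_ns: "i \<le> n \<Longrightarrow> omit_form i \<in> ns_forms"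
  using omit_form_pfister pfister_ns by blast

lemma omit_form_carrier: "i \<le> n \<Longrightarrow> omit_form i \<in> carrier_mat (2 ^ n) (2 ^ n)"
  using qpfister_carrier[of "map \<alpha> (tl (omit i))" "prod \<alpha> ({..n} - {i})"] omit_props(3)[of i] n
  by (simp add: omit_form_def flip: power_Suc)

lemma omit_form_good:
  assumes "i \<le> n"
  shows "good_form ({..n} - {i}) ({..n} - {i} - set (tl (omit i))) (omit_form i)"
proof -
  obtain k ls where kl: "omit i = k # ls" using omit_Cons[OF assms] .
  show ?thesis
    unfolding omit_form_def
    by (rule good_form_qpfister[OF two, of _ k]) (use kl omit_props(1,2)[of i] in auto)
qed

lemma of_form_omit_form:
  assumes "i \<le> n"
  shows "of_form (omit_form i) = alt_class {#\<alpha> j. j \<in># mset_set ({..n} - {i})#}"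
proof -
  obtain k ls where kl: "omit i = k # ls" using omit_Cons[OF assms] .
  have ls: "set ls \<subseteq> {..n}" using kl omit_props(1)[of i] by auto
  have "prod \<alpha> ({..n} - {i}) = prod_list (map \<alpha> (omit i))"
    using omit_props(1,2)[of i] by (simp flip: omit_props(1)[of i] add: prod.distinct_set_conv_list)
  then have "omit_form i = qpfister (map \<alpha> ls) (\<alpha> k * prod_list (map \<alpha> ls))"
    by (simp add: omit_form_def kl)
  moreover have nz: "0 \<notin> set (map \<alpha> ls)" using ls var_nz by force
  ultimately have "of_form (omit_form i) = alt_class (add_mset (\<alpha> k) (mset (map \<alpha> ls)))"
    by (simp only: of_form_qpfister[OF two nz] alt_class_add[OF two])
  also have "add_mset (\<alpha> k) (mset (map \<alpha> ls)) = {#\<alpha> j. j \<in># mset (omit i)#}" by (simp add: kl)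
  also have "mset (omit i) = mset_set ({..n} - {i})"
    using mset_set_set[OF omit_props(2)[of i]] omit_props(1)[of i] by simp
  finally show ?thesis .
qed

lemma omit_form_double: "i \<le> n \<Longrightarrow> of_form (omit_form i) + of_form (omit_form i) = 0"
proof -
  assume i: "i \<le> n"
  have "card ({..n} - {i}) > 0" using i n by simp
  then have "{#\<alpha> j. j \<in># mset_set ({..n} - {i})#} \<noteq> {#}" by (auto simp: mset_set_empty_iff card_gt_0_iff)
  then show ?thesis unfolding of_form_omit_form[OF i] by (rule alt_class_double[OF two])
qed

lemma sum_omit_form_pfister:
  assumes "I \<subseteq> {..n}"
  shows "(\<Sum>i\<in>I. of_form (omit_form i)) \<in> of_form ` quadratic_pfister_forms n"
proof (cases "I = {}")
  case True
  then show ?thesis using zero_in_pfister[OF two] by simp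
next
  case False
  then obtain k where k: "k \<in> I" by blast
  let ?Y = "{#if j \<in> I then \<alpha> j + \<alpha> k else \<alpha> j. j \<in># mset_set ({..n} - {k})#}"
  have "(\<Sum>i\<in>I. of_form (omit_form i)) = (\<Sum>i\<in>I. alt_class {#\<alpha> j. j \<in># mset_set ({..n} - {i})#})"
    using assms by (intro sum.cong) (auto simp: of_form_omit_form)
  also have "\<dots> = alt_class ?Y" using assms k by (intro alt_class_sum_omit[OF two]) auto
  also have "alt_class ?Y \<in> of_form ` quadratic_pfister_forms n"
  proof (rule alt_class_pfister[OF two])
    have k': "k \<le> n" using assms k by auto
    then show "size ?Y = n" by simp
    \<comment> \<open>Slots must be nonzero; equality of the two variables is excluded since their
      absolute values are different primes.\<close>
    have "\<alpha> j + \<alpha> k \<noteq> 0" if "j \<le> n" "j \<noteq> k" for j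
    proof
      assume "\<alpha> j + \<alpha> k = 0"
      then have "\<alpha> j = \<alpha> k" using double_eq_0[OF two, of "\<alpha> k"] by (metis add_right_imp_eq)
      then have "absv (\<alpha> j) = absv (\<alpha> k)" by simp
      then show False using that k' by (simp add: absv_var)
    qed
    then show "0 \<notin># ?Y" using var_nz by (auto split: if_splits) (metis)+
  qed (use n in simp)
  finally show ?thesis .
qed

lemma strongly_tight_omit: "strongly_tight n (omit_form ` {..n})"
proof -
  let ?w = "\<lambda>i. of_form (omit_form i)"
  \<comment> \<open>All subset sums, with \<open>P\<close> marking the subset. Every class has order
    at most two, so these sums form a subgroup, addition being symmetric difference of the
    subsets.\<close>
  define H where "H = {\<Sum>i\<le>n. if P i then ?w i else 0 | P. True}"
  have "generate (Iq n) (witt_class ` omit_form ` {..n}) \<subseteq> Rep_witt ` H"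
  proof (rule generate_Iq_subset)
    show "omit_form ` {..n} \<subseteq> quadratic_pfister_forms n"
      using omit_form_pfister by auto
    show "quadratic_pfister_forms n \<subseteq> (ns_forms :: 'e mat set)" by (rule pfister_ns)
    show "0 \<in> H" unfolding H_def by (intro CollectI exI[of _ "\<lambda>_. False"]) simp
    show "x + y \<in> H" if "x \<in> H" "y \<in> H" for x y
    proof -
      obtain P where x: "x = (\<Sum>i\<le>n. if P i then ?w i else 0)" using \<open>x \<in> H\<close> by (auto simp: H_def)
      obtain Q where y: "y = (\<Sum>i\<le>n. if Q i then ?w i else 0)" using \<open>y \<in> H\<close> by (auto simp: H_def)
      have "x + y = (\<Sum>i\<le>n. if P i \<noteq> Q i then ?w i else 0)"
        unfolding x y sum.distrib[symmetric] by (intro sum.cong) (auto simp: omit_form_double)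
      then show ?thesis unfolding H_def by (intro CollectI exI[of _ "\<lambda>i. P i \<noteq> Q i"]) simp
    qed
    show "- x \<in> H" if x: "x \<in> H" for x
    proof -
      obtain P where P: "x = (\<Sum>i\<le>n. if P i then ?w i else 0)" using x by (auto simp: H_def)
      have "x + x = 0"
        unfolding P sum.distrib[symmetric] by (rule sum.neutral) (auto simp: omit_form_double)
      then show ?thesis using x by (simp add: minus_unique)
    qed
    show "of_form ` omit_form ` {..n} \<subseteq> H"
    proof
      fix x assume "x \<in> of_form ` omit_form ` {..n}"
      then obtain i where "i \<le> n" "x = ?w i" by auto
      then have "x = (\<Sum>j\<le>n. if j = i then ?w j else 0)" by simp
      then show "x \<in> H" unfolding H_def by (intro CollectI exI[of _ "\<lambda>j. j = i"]) simp
    qed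
  qed
  also have "Rep_witt ` H \<subseteq> Rep_witt ` of_form ` quadratic_pfister_forms n"
  proof (intro image_mono subsetI)
    fix x assume "x \<in> H"
    then obtain P where "x = (\<Sum>i\<le>n. if P i then ?w i else 0)" by (auto simp: H_def)
    then have "x = (\<Sum>i\<in>{i\<in>{..n}. P i}. ?w i)" by (simp only: sum.inter_filter[OF finite_atMost])
    then show "x \<in> of_form ` quadratic_pfister_forms n" using sum_omit_form_pfister[of "{i\<in>{..n}. P i}"]
      by (simp only:) blast
  qed
  also have "\<dots> = witt_class ` quadratic_pfister_forms n"
    unfolding image_image using pfister_ns by (intro image_cong refl Rep_of_form) blast
  finally show ?thesis unfolding strongly_tight_def .
qed

text \<open>The form omitting \<open>\<alpha> j\<close> represents its last slot, which has odd
  degree in \<open>\<alpha> i\<close>, whereas all nonzero values of the form omitting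
  \<open>\<alpha> i\<close> have even degree in it.\<close>

lemma omit_form_not_isometric:
  assumes "i \<le> n" "j \<le> n" "i \<noteq> j"
  shows "\<not> isometric (omit_form j) (omit_form i)"
proof
  assume iso: "isometric (omit_form j) (omit_form i)"
  have "has_plane 1 (prod \<alpha> ({..n} - {j})) (omit_form j)"
    unfolding omit_form_def by (rule has_plane_qpfister)
  from has_plane_isometric[OF iso this] have "has_plane 1 (prod \<alpha> ({..n} - {j})) (omit_form i)"
    using omit_form_ns assms by blast
  then obtain u w where uw: "u \<in> carrier_vec (2 ^ n)" "w \<in> carrier_vec (2 ^ n)"
    "\<And>x y. quad_eval (omit_form i) (x \<cdot>\<^sub>v u + y \<cdot>\<^sub>v w) = x\<^sup>2 + 1 * (x * y) + prod \<alpha> ({..n} - {j}) * y\<^sup>2"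
    "\<And>x y. x \<cdot>\<^sub>v u + y \<cdot>\<^sub>v w = 0\<^sub>v (2 ^ n) \<Longrightarrow> x = 0 \<and> y = 0"
    using has_planeE omit_form_carrier[OF assms(1)] by blast
  let ?v = "0 \<cdot>\<^sub>v u + 1 \<cdot>\<^sub>v w"
  have v: "?v \<in> carrier_vec (2 ^ n)" "?v \<noteq> 0\<^sub>v (2 ^ n)" "quad_eval (omit_form i) ?v = prod \<alpha> ({..n} - {j})"
    using uw(1,2) uw(4)[of 0 1] uw(3)[of 0 1] by auto
  have dim: "dim_row (omit_form i) = 2 ^ n" using omit_form_carrier[OF assms(1)] by simp
  have "good_val ({..n} - {i}) ({..n} - {i} - set (tl (omit i))) (quad_eval (omit_form i) ?v)"
    using omit_form_good[OF assms(1)] v(1,2) unfolding good_form_def dim by blast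
  then have "even_deg i (prod \<alpha> ({..n} - {j}))"
    unfolding v(3) using assms by (auto intro: good_val_even)
  then show False using prod_var(3)[of "{..n} - {j}" i] assms by auto
qed

lemma no_common_plane_omit:
  assumes "\<And>\<phi>. \<phi> \<in> omit_form ` {..n} \<Longrightarrow> has_plane e c \<phi>" "e \<in> {0, 1}"
  shows False
  by (rule no_common_plane[of omit_form "2 ^ n" "\<lambda>i. {..n} - {i} - set (tl (omit i))" e c])
     (use assms two omit_form_carrier omit_form_good pols_0 pols_1 in auto)

lemma not_common_subform_omit:
  "\<not> common_quadratic_subform (omit_form ` {..n})" "\<not> common_bilinear_subform (omit_form ` {..n})"
  unfolding common_quadratic_subform_def common_bilinear_subform_def
    qpfister1_def binary_form_def bpfister1_def
  using no_common_plane_omit has_plane_subform omit_form_carrier by blast+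

text \<open>Linkage produces a common plane: x^2 + b y^2 from a common bilinear slot b, and [1, a]
  from a common quadratic factor with last slot a.\<close>

lemma not_linked_omit: "\<not> left_linked n (omit_form ` {..n})" "\<not> right_linked n (omit_form ` {..n})"
proof -
  show "\<not> left_linked n (omit_form ` {..n})"
  proof
    assume "left_linked n (omit_form ` {..n})"
    then obtain bs where bs: "length bs = n - 1" "0 \<notin> set bs"
      "\<And>\<phi>. \<phi> \<in> omit_form ` {..n} \<Longrightarrow> \<exists>a. isometric \<phi> (qpfister bs a)"
      unfolding left_linked_def bilinear_pfister_forms_def qpfister_def by blast
    \<comment> \<open>A common slot exists because n - 1 is at least 1.\<close>
    obtain b bs' where b: "bs = b # bs'" using bs n by (cases bs) auto
    have "has_plane 0 b \<phi>" if \<phi>: "\<phi> \<in> omit_form ` {..n}" for \<phi>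
    proof -
      obtain a where a: "isometric \<phi> (qpfister bs a)" using bs \<phi> by blast
      have ns: "\<phi> \<in> ns_forms" "qpfister bs a \<in> ns_forms"
        using \<phi> omit_form_ns qpfister_ns[OF two bs(2)] by auto
      from has_plane_isometric[OF isometric_sym[OF a ns] _ ns(2,1)] show ?thesis
        unfolding b by (simp add: has_plane_qpfister_slot)
    qed
    then show False using no_common_plane_omit by blast
  qed
  show "\<not> right_linked n (omit_form ` {..n})"
  proof
    assume "right_linked n (omit_form ` {..n})"
    then obtain bs a where bs: "0 \<notin> set bs"
      "\<And>\<phi>. \<phi> \<in> omit_form ` {..n} \<Longrightarrow> \<exists>b. b \<noteq> 0 \<and> isometric \<phi> (tensor (bpfister1 b) (qpfister bs a))"
      unfolding right_linked_def quadratic_pfister_forms_eq by blast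
    have "has_plane 1 a \<phi>" if \<phi>: "\<phi> \<in> omit_form ` {..n}" for \<phi>
    proof -
      obtain b where b: "b \<noteq> 0" "isometric \<phi> (qpfister (b # bs) a)"
        using bs \<phi> by (auto simp: qpfister_def tensor_assoc)
      have ns: "\<phi> \<in> ns_forms" "qpfister (b # bs) a \<in> ns_forms"
        using \<phi> omit_form_ns qpfister_ns[OF two, of "b # bs"] bs(1) b(1) by auto
      show ?thesis
        by (rule has_plane_isometric[OF isometric_sym[OF b(2) ns] has_plane_qpfister ns(2,1)])
    qed
    then show False using no_common_plane_omit by blast
  qed
qed

end

end

theorem theorem9p1:
  fixes n :: nat
    and \<iota> :: "'k::field \<Rightarrow> 'e::field"
    and \<alpha> :: "nat \<Rightarrow> 'e"
  assumes "n \<ge> 2"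
    and "CHAR('k) = 2"
    and "rational_function_field \<iota> n \<alpha>"
  shows "\<exists>S :: 'e mat set.
    S \<subseteq> quadratic_pfister_forms n \<and>
    card S = n + 1 \<and>
    (\<forall>\<phi>\<in>S. \<forall>\<psi>\<in>S. \<phi> \<noteq> \<psi> \<longrightarrow> \<not> isometric \<phi> \<psi>) \<and>
    strongly_tight n S \<and>
    \<not> common_quadratic_subform S \<and>
    \<not> common_bilinear_subform S \<and>
    \<not> left_linked n S \<and>
    \<not> right_linked n S"
proof -
  interpret rational_functions \<iota> n \<alpha> by unfold_locales (rule assms(3))
  have "of_nat 2 = (0 :: 'k)" using of_nat_CHAR[where 'a = 'k] assms(2) by simp
  then have "(1 + 1 :: 'k) = 0" by simp
  moreover have "(2::'e) = \<iota> (1 + 1)" by (metis \<iota>.hom_add \<iota>.hom_one one_add_one)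
  ultimately have two: "(2::'e) = 0" by (simp only: \<iota>.hom_zero)
  note facts = omit_form_pfister[OF two assms(1)] strongly_tight_omit[OF two assms(1)]
    not_common_subform_omit[OF two assms(1)] not_linked_omit[OF two assms(1)]
  have noniso: "\<not> isometric (omit_form i) (omit_form j)" if "i \<le> n" "j \<le> n" "i \<noteq> j" for i j
    using omit_form_not_isometric[OF two assms(1)] that by blast
  \<comment> \<open>Each form is isometric to itself, so non-isometric forms are different matrices
    and the set has n + 1 elements.\<close>
  have "inj_on omit_form {..n}"
    using noniso isometric_refl[OF omit_form_ns[OF two assms(1)]] by (intro inj_onI) (metis atMost_iff)
  then have "card (omit_form ` {..n}) = n + 1" by (simp add: card_image)
  moreover have "\<forall>\<phi>\<in>omit_form ` {..n}. \<forall>\<psi>\<in>omit_form ` {..n}. \<phi> \<noteq> \<psi> \<longrightarrow> \<not> isometric \<phi> \<psi>"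
    using noniso by auto
  moreover have "omit_form ` {..n} \<subseteq> quadratic_pfister_forms n" using facts(1) by auto
  ultimately show ?thesis using facts(2-) by blast
qed

end
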